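(* Let $F$ be an $n$-variate unsatisfiable CNF formula, and let $m,w\in\mathbb{N}$ and $\delta>0$ satisfy $w\le n$, $0<\delta<1-\frac{1}{\log m}$ and $m\ge(\frac{50n}{\delta})^{2/\delta}$. If there is a triangle-DAG of size at most $\frac12 m^{(1-\delta)w}$ and depth $d$ solving $\mathrm{Search}(F)\circ\mathrm{IND}_m^n$, then $F$ has a resolution refutation of width $w$ and depth $dw$.
   Context: For $F=C_1\land\dots\land C_\ell$ over $z_1,\dots,z_n$, $\mathrm{Search}(F)\subseteq\{0,1\}^n\times[\ell]$ contains $(z,i)$ iff $C_i(z)=0$. $\mathrm{IND}_m:[m]\times\{0,1\}^m\to\{0,1\}$ is $\mathrm{IND}_m(x,y)=y_x$. The composed search problem $\mathrm{Search}(F)\circ\mathrm{IND}_m^n$ has inputs $(x,y)\in[m]^n\times(\{0,1\}^m)^n$ and $((x,y),i)$ is a valid pair iff $C_i(z)=0$ where $z_j=\mathrm{IND}_m(x_j,y_j)$. A triangle in $X\times Y$ (here $X=[m]^n$, $Y=\{0,1\}^{mn}$) is a set $\{(x,y):a(x)<b(y)\}$ for some functions $a:X\to\mathbb{R}$, $b:Y\to\mathbb{R}$. A triangle-DAG solving a search problem $\mathcal{S}\subseteq(X\times Y)\times\mathcal{O}$ is a rooted DAG of fan-in at most 2 with each node $v$ labeled by a triangle $S_v$ such that the root is labeled $X\times Y$, if $u$ has children $v,w$ then $S_u\subseteq S_v\cup S_w$, and for each leaf $\ell$ there is $o\in\mathcal{O}$ with $((x,y),o)\in\mathcal{S}$ for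 all $(x,y)\in S_\ell$. Size is the number of nodes; depth is the longest root-to-leaf path length. Resolution refutation width is the maximal number of literals in a clause; depth is the longest path in the derivation DAG. Logarithms are base 2. *)

theory Defs
  imports Complex_Main "HOL-Library.FuncSet"
begin

text \<open>
  Conventions: \<open>[k]\<close> is rendered as \<open>{..<k}\<close> (indices start at 0), \<open>{0,1}\<close> as \<^typ>\<open>bool\<close>, and
  tuples over an index set \<open>I\<close> as extensional functions, i.e. elements of \<open>I \<rightarrow>\<^sub>E B\<close>.
\<close>

subsection \<open>CNF formulas and their search problems\<close>

datatype literal = Pos nat | Neg nat

fun lit_var :: "literal \<Rightarrow> nat" where
  "lit_var (Pos j) = j"
| "lit_var (Neg j) = j"

fun lit_val :: "(nat \<Rightarrow> bool) \<Rightarrow> literal \<Rightarrow> bool" where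
  "lit_val z (Pos j) = z j"
| "lit_val z (Neg j) = (\<not> z j)"

type_synonym clause = "literal set"
type_synonym cnf = "clause list"

definition clause_val :: "(nat \<Rightarrow> bool) \<Rightarrow> clause \<Rightarrow> bool" where
  "clause_val z C \<longleftrightarrow> (\<exists>l\<in>C. lit_val z l)"

definition cube :: "nat \<Rightarrow> (nat \<Rightarrow> bool) set" where
  "cube k = {..<k} \<rightarrow>\<^sub>E UNIV"

definition cnf_over :: "nat \<Rightarrow> cnf \<Rightarrow> bool" where
  "cnf_over n F \<longleftrightarrow> (\<forall>C\<in>set F. finite C \<and> lit_var ` C \<subseteq> {..<n})"

definition unsatisfiable :: "nat \<Rightarrow> cnf \<Rightarrow> bool" where
  "unsatisfiable n F \<longleftrightarrow> \<not> (\<exists>z\<in>cube n. \<forall>C\<in>set F. clause_val z C)"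

definition search :: "nat \<Rightarrow> cnf \<Rightarrow> ((nat \<Rightarrow> bool) \<times> nat) set" where
  "search n F = {(z, i). z \<in> cube n \<and> i < length F \<and> \<not> clause_val z (F ! i)}"

definition ind :: "nat \<Rightarrow> (nat \<Rightarrow> bool) \<Rightarrow> bool" where
  "ind x y = y x"

definition ind_X :: "nat \<Rightarrow> nat \<Rightarrow> (nat \<Rightarrow> nat) set" where
  "ind_X m n = {..<n} \<rightarrow>\<^sub>E {..<m}"

definition ind_Y :: "nat \<Rightarrow> nat \<Rightarrow> (nat \<Rightarrow> nat \<Rightarrow> bool) set" where
  "ind_Y m n = {..<n} \<rightarrow>\<^sub>E cube m"

definition compose_ind ::
  "nat \<Rightarrow> nat \<Rightarrow> ((nat \<Rightarrow> bool) \<times> 'o) set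
    \<Rightarrow> (((nat \<Rightarrow> nat) \<times> (nat \<Rightarrow> nat \<Rightarrow> bool)) \<times> 'o) set" where
  "compose_ind m n P =
    {((x, y), i). x \<in> ind_X m n \<and> y \<in> ind_Y m n \<and> ((\<lambda>j\<in>{..<n}. ind (x j) (y j)), i) \<in> P}"

subsection \<open>Rooted DAGs\<close>

text \<open>Edges point from a node to its children, i.e. away from the root.\<close>

record 'v rdag =
  nodes :: "'v set"
  edges :: "('v \<times> 'v) set"
  dag_root :: 'v

definition rooted_dag :: "'v rdag \<Rightarrow> bool" where
  "rooted_dag G \<longleftrightarrow>
    finite (nodes G) \<and> edges G \<subseteq> nodes G \<times> nodes G \<and> acyclic (edges G) \<and>
    dag_root G \<in> nodes G \<and> (\<forall>v\<in>nodes G. (dag_root G, v) \<in> (edges G)\<^sup>*)"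

definition children :: "'v rdag \<Rightarrow> 'v \<Rightarrow> 'v set" where
  "children G u = edges G `` {u}"

definition leaves :: "'v rdag \<Rightarrow> 'v set" where
  "leaves G = {v \<in> nodes G. children G v = {}}"

definition dag_size :: "'v rdag \<Rightarrow> nat" where
  "dag_size G = card (nodes G)"

definition dag_depth :: "'v rdag \<Rightarrow> nat" where
  "dag_depth G = Max {k. \<exists>l\<in>leaves G. (dag_root G, l) \<in> edges G ^^ k}"

definition longest_path :: "'v rdag \<Rightarrow> nat" where
  "longest_path G = Max {k. \<exists>u\<in>nodes G. \<exists>v\<in>nodes G. (u, v) \<in> edges G ^^ k}"

subsection \<open>Triangle-DAGs\<close>

definition triangle :: "'a set \<Rightarrow> 'b set \<Rightarrow> ('a \<times> 'b) set \<Rightarrow> bool" where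
  "triangle X Y T \<longleftrightarrow>
    (\<exists>(a :: 'a \<Rightarrow> real) (b :: 'b \<Rightarrow> real). T = {(x, y). x \<in> X \<and> y \<in> Y \<and> a x < b y})"

definition solving_triangle_dag ::
  "'a set \<Rightarrow> 'b set \<Rightarrow> 'o set \<Rightarrow> (('a \<times> 'b) \<times> 'o) set \<Rightarrow> 'v rdag \<Rightarrow> ('v \<Rightarrow> ('a \<times> 'b) set) \<Rightarrow> bool"
  where
  "solving_triangle_dag X Y Out P G S \<longleftrightarrow>
    rooted_dag G \<and>
    (\<forall>u\<in>nodes G. card (children G u) \<le> 2) \<and>
    (\<forall>u\<in>nodes G. triangle X Y (S u)) \<and>
    S (dag_root G) = X \<times> Y \<and>
    (\<forall>u\<in>nodes G - leaves G. S u \<subseteq> (\<Union>v\<in>children G u. S v)) \<and>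
    (\<forall>l\<in>leaves G. \<exists>r\<in>Out. \<forall>p\<in>S l. (p, r) \<in> P)"

subsection \<open>Resolution\<close>

definition resolvent :: "clause \<Rightarrow> clause \<Rightarrow> clause \<Rightarrow> bool" where
  "resolvent A B C \<longleftrightarrow>
    (\<exists>j. Pos j \<in> A \<and> Neg j \<in> B \<and> C = (A - {Pos j}) \<union> (B - {Neg j}))"

text \<open>
  A refutation is given by its derivation DAG: the root is the empty clause, leaves are clauses
  of \<open>F\<close>, and the children of an inner node are its two premises.
\<close>

definition resolution_refutation :: "cnf \<Rightarrow> 'v rdag \<Rightarrow> ('v \<Rightarrow> clause) \<Rightarrow> bool" where
  "resolution_refutation F G cl \<longleftrightarrow>
    rooted_dag G \<and>
    cl (dag_root G) = {} \<and>
    (\<forall>u\<in>leaves G. cl u \<in> set F) \<and>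
    (\<forall>u\<in>nodes G - leaves G. \<exists>v w. children G u = {v, w} \<and> resolvent (cl v) (cl w) (cl u))"

definition refutation_width :: "'v rdag \<Rightarrow> ('v \<Rightarrow> clause) \<Rightarrow> nat" where
  "refutation_width G cl = Max ((\<lambda>u. card (cl u)) ` nodes G)"

end

theory Submission
  imports "HOL-Analysis.Harmonic_Numbers" Defs
begin

text \<open>
  Walk down the triangle-DAG keeping a rectangle \<open>A \<times> B\<close> inside the current triangle, where the
  pointers in \<open>A\<close> are constant on a set \<open>J\<close> of at most \<open>w\<close> coordinates and spread on the others
  (no cylinder of codimension \<open>k\<close> has relative measure above \<open>m\<close> to the power \<open>- \<delta> k\<close>), and \<open>B\<close> is a dense subset
  of the \<open>y\<close> whose pointed-to bits on \<open>J\<close> form a given assignment \<open>\<beta>\<close>. Such a state stands for the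
  clause over \<open>J\<close> falsified by \<open>\<beta>\<close>.

  If \<open>A \<times> B\<close> is covered by two triangles, half of \<open>A\<close> times half of \<open>B\<close> lies in one of them. A
  robust sunflower lemma for two-coloured sets gives one \<open>x\<close> in that half of \<open>A\<close> for which all extensions of \<open>\<beta>\<close> are
  realised by elements of that half of \<open>B\<close>. In the child's triangle, \<open>x\<close> lies above a spread set with
  some core \<open>J'\<close>, so every assignment of \<open>J'\<close> compatible with \<open>\<beta>\<close> yields a state at that child.
  Resolving out \<open>J' - J\<close> costs at most \<open>w\<close> steps and all clauses stay within \<open>J'\<close>. At a leaf,
  realising all extensions of \<open>\<beta>\<close> forces a clause of \<open>F\<close> to be falsified by \<open>\<beta>\<close>.

  Elements \<open>x\<close> without a core of size at most \<open>w\<close> and elements \<open>y\<close> in sparse sets are discarded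
  beforehand; the size bound on the DAG keeps the discarded sets small.
\<close>

subsection \<open>A robust sunflower lemma for coloured sets\<close>

text \<open>AM-GM in the normalised form that averaging needs: each factor
  \<open>q i / \<mu>\<close> is at most \<open>exp (q i / \<mu> - 1)\<close>, and these exponents
  add up to at most 0.\<close>

lemma prod_le_power_mean:
  fixes q :: "'b \<Rightarrow> real"
  assumes "finite I" "0 < \<mu>" "\<And>i. i \<in> I \<Longrightarrow> 0 \<le> q i" "sum q I \<le> \<mu> * real (card I)"
  shows "prod q I \<le> \<mu> ^ card I"
proof -
  have "(\<Prod>i\<in>I. q i / \<mu>) \<le> (\<Prod>i\<in>I. exp (q i / \<mu> - 1))"
    using assms by (intro prod_mono) (auto intro: order_trans[OF _ exp_ge_add_one_self])
  also have "\<dots> = exp (\<Sum>i\<in>I. q i / \<mu> - 1)" using assms by (simp add: exp_sum)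
  also have "(\<Sum>i\<in>I. q i / \<mu> - 1) = sum q I / \<mu> - real (card I)"
    by (simp add: sum_subtractf sum_divide_distrib)
  also have "exp \<dots> \<le> 1" using assms by (simp add: field_simps)
  finally show ?thesis using assms by (simp add: prod_dividef)
qed

context
  fixes A :: "'a set" and s :: "'a \<Rightarrow> ('u \<times> bool) set" and U :: "'u set"
begin

text \<open>A state is a \<open>K\<close>-colouring of \<open>U\<close> glued to a bit vector on
  \<open>U\<close>, so counting states replaces probabilities over an independent uniform colouring
  and a uniform \<open>y\<close>.\<close>

definition states :: "nat \<Rightarrow> ('u \<Rightarrow> nat \<times> bool) set" where
  "states K = U \<rightarrow>\<^sub>E ({..<K} \<times> UNIV)"

definition revealed :: "('u \<Rightarrow> nat \<times> bool) \<Rightarrow> nat \<Rightarrow> ('u \<times> bool) set" where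
  "revealed \<omega> a = {(u, v). u \<in> U \<and> \<omega> u = (a, v)}"

text \<open>The bit at \<open>u\<close> is read off as \<open>(u, True) \<in> T\<close>; this is the
  value that \<open>T\<close> assigns whenever \<open>T\<close> is the graph of a partial function,
  as subsets of \<open>s x\<close> for \<open>x \<in> A\<close> are.\<close>

definition overwrite :: "nat \<Rightarrow> ('u \<times> bool) set \<Rightarrow> ('u \<Rightarrow> nat \<times> bool) \<Rightarrow> 'u \<Rightarrow> nat \<times> bool" where
  "overwrite b T \<omega> = (\<lambda>u. if u \<in> fst ` T then (b, (u, True) \<in> T) else \<omega> u)"

text \<open>The minimum fragment from proofs of spread lemmas. \<open>C\<close> and \<open>g\<close>
  are parameters because the second round runs on the residues that the first round leaves.\<close>

definition fragment ::
  "'a set \<Rightarrow> ('a \<Rightarrow> ('u \<times> bool) set) \<Rightarrow> ('u \<times> bool) set \<Rightarrow> 'a \<Rightarrow> ('u \<times> bool) set" where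
  "fragment C g W x = arg_min card (\<lambda>T. \<exists>x'\<in>C. T = g x' - W \<and> T \<subseteq> g x)"

text \<open>
  Pairs where colour \<open>a\<close> reveals a wrong value of \<open>x\<close> are set aside: for all others, writing a part of
  \<open>s x\<close> into another colour leaves \<open>revealed \<omega> a\<close> unchanged, so that the encoding can be iterated.
\<close>

definition clashing :: "nat \<Rightarrow> nat \<Rightarrow> ('a \<times> ('u \<Rightarrow> nat \<times> bool)) set" where
  "clashing K a = {(x, \<omega>). x \<in> A \<and> \<omega> \<in> states K \<and> (\<exists>u v. (u, v) \<in> s x \<and> \<omega> u = (a, \<not> v))}"

definition failing :: "nat \<Rightarrow> nat \<Rightarrow> nat \<Rightarrow> ('u \<Rightarrow> nat \<times> bool) set" where
  "failing K a b = {\<omega> \<in> states K. \<not> (\<exists>x\<in>A. s x \<subseteq> revealed \<omega> a \<union> revealed \<omega> b)}"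

definition missed :: "('u \<Rightarrow> bool) set" where
  "missed = {y \<in> U \<rightarrow>\<^sub>E UNIV. \<not> (\<exists>x\<in>A. \<forall>(u, v)\<in>s x. y u = v)}"

text \<open>The factor 2 in \<open>spread\<close> pays for halving: the family will be half of a set
  that is spread with constant 1.\<close>

context
  fixes n :: nat and \<kappa> :: real
  assumes finite_A: "finite A" and A_ne: "A \<noteq> {}" and finite_U: "finite U"
    and s_dom: "\<And>x. x \<in> A \<Longrightarrow> fst ` s x \<subseteq> U"
    and s_inj: "\<And>x. x \<in> A \<Longrightarrow> inj_on fst (s x)"
    and s_card: "\<And>x. x \<in> A \<Longrightarrow> card (s x) \<le> n"
    and \<kappa>_pos: "0 < \<kappa>"
    and spread: "\<And>T. finite T \<Longrightarrow> real (card {x \<in> A. T \<subseteq> s x}) * \<kappa> ^ card T \<le> 2 * real (card A)"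
begin

lemma finite_states: "finite (states K)"
  unfolding states_def using finite_U by (intro finite_PiE) auto

lemma finite_s: "x \<in> A \<Longrightarrow> finite (s x)"
  by (meson finite_U finite_imageD finite_subset s_dom s_inj)

lemma card_states: "card (states K) = (2 * K) ^ card U"
  unfolding states_def using finite_U by (simp add: card_PiE card_cartesian_product)

lemma fragment_origin:
  assumes "x \<in> C"
  shows "\<exists>x'\<in>C. fragment C g W x = g x' - W" and "fragment C g W x \<subseteq> g x"
proof -
  have "\<exists>x'\<in>C. fragment C g W x = g x' - W \<and> fragment C g W x \<subseteq> g x"
    unfolding fragment_def
    by (rule arg_min_natI[where k = "g x - W"]) (use assms in auto)
  then show "\<exists>x'\<in>C. fragment C g W x = g x' - W" "fragment C g W x \<subseteq> g x" by auto
qed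

lemma fragment_minimal:
  assumes "x' \<in> C" "g x' - W \<subseteq> g x"
  shows "card (fragment C g W x) \<le> card (g x' - W)"
  unfolding fragment_def by (rule arg_min_nat_le) (use assms in auto)

lemma s_functional: "x \<in> A \<Longrightarrow> (u, v) \<in> s x \<Longrightarrow> (u, v') \<in> s x \<Longrightarrow> v = v'"
  using inj_onD[OF s_inj, of x "(u, v)" "(u, v')"] by simp

lemma overwrite_mem:
  assumes "T \<subseteq> s x" "x \<in> A" "(u, v) \<in> T"
  shows "overwrite b T \<omega> u = (b, v)"
proof -
  have "(u, True) \<in> T \<longleftrightarrow> v"
    using assms s_functional[OF assms(2), of u v True] by (cases v) auto
  moreover have "u \<in> fst ` T" using assms(3) by force
  ultimately show ?thesis by (simp add: overwrite_def)
qed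

lemma overwrite_states:
  assumes "T \<subseteq> s x" "x \<in> A" "\<omega> \<in> states K" "b < K"
  shows "overwrite b T \<omega> \<in> states K"
proof -
  have "fst ` T \<subseteq> U" using s_dom[OF assms(2)] assms(1) by blast
  then show ?thesis using assms(3,4)
    unfolding states_def overwrite_def by (auto simp: PiE_iff extensional_def subset_iff)
qed

text \<open>Counts how many states could have been the original once everything outside
  \<open>P\<close> is known: the price of undoing an \<open>overwrite\<close>.\<close>

lemma card_states_agreeing:
  assumes "P \<subseteq> U"
  shows "card {\<omega> \<in> states K. \<forall>u. u \<notin> P \<longrightarrow> \<omega> u = \<omega>' u} \<le> (2 * K) ^ card P"
proof -
  have fP: "finite P" using assms finite_U finite_subset by blast
  have "card {\<omega> \<in> states K. \<forall>u. u \<notin> P \<longrightarrow> \<omega> u = \<omega>' u} \<le> card (P \<rightarrow>\<^sub>E ({..<K} \<times> (UNIV :: bool set)))"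
  proof (rule card_inj_on_le[where f = "\<lambda>\<omega>. restrict \<omega> P"])
    show "inj_on (\<lambda>\<omega>. restrict \<omega> P) {\<omega> \<in> states K. \<forall>u. u \<notin> P \<longrightarrow> \<omega> u = \<omega>' u}"
    proof (rule inj_onI, goal_cases)
      case (1 \<omega>1 \<omega>2)
      show ?case
      proof
        fix u show "\<omega>1 u = \<omega>2 u"
          using 1 by (cases "u \<in> P") (auto dest: fun_cong[where x = u])
      qed
    qed
    show "(\<lambda>\<omega>. restrict \<omega> P) ` {\<omega> \<in> states K. \<forall>u. u \<notin> P \<longrightarrow> \<omega> u = \<omega>' u} \<subseteq> P \<rightarrow>\<^sub>E ({..<K} \<times> UNIV)"
    proof (rule image_subsetI)
      fix \<omega> assume "\<omega> \<in> {\<omega> \<in> states K. \<forall>u. u \<notin> P \<longrightarrow> \<omega> u = \<omega>' u}"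
      then have "\<omega> \<in> U \<rightarrow>\<^sub>E ({..<K} \<times> UNIV)" by (simp add: states_def)
      then show "restrict \<omega> P \<in> P \<rightarrow>\<^sub>E ({..<K} \<times> UNIV)"
        using assms by (intro restrict_PiE_iff[THEN iffD2]) (auto simp: PiE_iff)
    qed
  qed (use fP in \<open>auto intro: finite_PiE\<close>)
  also have "\<dots> = (2 * K) ^ card P"
    using fP by (simp add: card_PiE card_cartesian_product)
  finally show ?thesis .
qed

text \<open>
  Rao's encoding: writing the minimal fragment \<open>T\<close> of \<open>(x, \<omega>)\<close> into \<open>\<omega>\<close> gives a state \<open>\<omega>'\<close> in
  which some canonical member is fully revealed, and minimality forces \<open>T\<close> to be a subset of that
  member. So \<open>T\<close> costs only a binomial coefficient, \<open>x\<close> is then pinned down by spreadness, and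
  \<open>\<omega>\<close> is recovered from \<open>\<omega>'\<close> up to its values on \<open>T\<close>.
\<close>

lemma card_fragment_eq_le:
  fixes C :: "('u \<Rightarrow> nat \<times> bool) \<Rightarrow> 'a set" and g :: "('u \<Rightarrow> nat \<times> bool) \<Rightarrow> 'a \<Rightarrow> ('u \<times> bool) set"
  assumes b: "b < K"
    and C: "\<And>\<omega> x. \<omega> \<in> states K \<Longrightarrow> x \<in> C \<omega> \<Longrightarrow> x \<in> A \<and> g \<omega> x \<subseteq> s x \<and> card (g \<omega> x) \<le> r"
    and H: "\<And>\<omega> x. (x, \<omega>) \<in> H \<Longrightarrow> \<omega> \<in> states K \<and> x \<in> C \<omega>"
    and inv: "\<And>\<omega> x T. (x, \<omega>) \<in> H \<Longrightarrow> T \<subseteq> g \<omega> x \<Longrightarrow>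
        C (overwrite b T \<omega>) = C \<omega> \<and> g (overwrite b T \<omega>) = g \<omega>"
  shows "real (card {p \<in> H. card (fragment (C (snd p)) (g (snd p)) (revealed (snd p) b) (fst p)) = i}) * \<kappa> ^ i
    \<le> 2 * real (r choose i) * real (2 * K) ^ i * (real (card (states K)) * real (card A))"
    (is "real (card ?B) * _ \<le> _")
proof -
  \<comment> \<open>Encoded states live in \<open>\<Omega>\<close>. The choice \<open>core\<close>
    depends on the state alone, so a decoder can recompute it without knowing
    \<open>x\<close>.\<close>
  define \<Omega> where "\<Omega> = {\<omega> \<in> states K. \<exists>x\<in>C \<omega>. g \<omega> x \<subseteq> revealed \<omega> b}"
  define core where "core \<omega> = (SOME x. x \<in> C \<omega> \<and> g \<omega> x \<subseteq> revealed \<omega> b)" for \<omega>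
  have core: "core \<omega> \<in> C \<omega>" "g \<omega> (core \<omega>) \<subseteq> revealed \<omega> b" if "\<omega> \<in> \<Omega>" for \<omega>
  proof -
    have "\<exists>x. x \<in> C \<omega> \<and> g \<omega> x \<subseteq> revealed \<omega> b" using that by (auto simp: \<Omega>_def)
    from someI_ex[OF this] show "core \<omega> \<in> C \<omega>" "g \<omega> (core \<omega>) \<subseteq> revealed \<omega> b"
      by (auto simp: core_def)
  qed
  define \<T> where "\<T> \<omega> = {T. T \<subseteq> g \<omega> (core \<omega>) \<and> card T = i}" for \<omega>
  \<comment> \<open>Contains every pair that can be encoded as \<open>(\<omega>, T)\<close>.\<close>
  define E where "E \<omega> T = {x \<in> A. T \<subseteq> s x} \<times> {\<omega>1 \<in> states K. \<forall>u. u \<notin> fst ` T \<longrightarrow> \<omega>1 u = \<omega> u}" for \<omega> T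
  have \<Omega>_sub: "\<Omega> \<subseteq> states K" by (auto simp: \<Omega>_def)
  have fin\<Omega>: "finite \<Omega>" using \<Omega>_sub finite_states finite_subset by blast
  have core_fin: "finite (g \<omega> (core \<omega>))" "card (g \<omega> (core \<omega>)) \<le> r" "core \<omega> \<in> A" "g \<omega> (core \<omega>) \<subseteq> s (core \<omega>)"
    if "\<omega> \<in> \<Omega>" for \<omega>
    using C[of \<omega> "core \<omega>"] core[OF that] \<Omega>_sub that finite_s[of "core \<omega>"] by (auto intro: finite_subset)
  have fin\<T>: "finite (\<T> \<omega>)" if "\<omega> \<in> \<Omega>" for \<omega>
    unfolding \<T>_def using core_fin[OF that] by auto
  have "?B \<subseteq> (\<Union>\<omega>\<in>\<Omega>. \<Union>T\<in>\<T> \<omega>. E \<omega> T)"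
  proof
    fix p assume p: "p \<in> ?B"
    obtain x \<omega> where p_eq: "p = (x, \<omega>)" by (cases p)
    from p p_eq have xH: "(x, \<omega>) \<in> H" by auto
    from H[OF xH] have \<omega>: "\<omega> \<in> states K" and xC: "x \<in> C \<omega>" by auto
    define W where "W = revealed \<omega> b"
    define T where "T = fragment (C \<omega>) (g \<omega>) W x"
    have cT: "card T = i" using p by (simp add: p_eq T_def W_def)
    from fragment_origin[OF xC, of "g \<omega>" W] obtain x' where
      x': "x' \<in> C \<omega>" "T = g \<omega> x' - W" and Tx: "T \<subseteq> g \<omega> x" by (auto simp: T_def)
    from C[OF \<omega> xC] have xA: "x \<in> A" and gx: "g \<omega> x \<subseteq> s x" by auto
    from C[OF \<omega> x'(1)] have x'A: "x' \<in> A" and gx': "g \<omega> x' \<subseteq> s x'" by auto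
    have Ts: "T \<subseteq> s x" using Tx gx by blast
    define \<omega>' where "\<omega>' = overwrite b T \<omega>"
    have \<omega>'S: "\<omega>' \<in> states K" unfolding \<omega>'_def by (rule overwrite_states[OF Ts xA \<omega> b])
    from inv[OF xH Tx] have same: "C \<omega>' = C \<omega>" "g \<omega>' = g \<omega>" by (auto simp: \<omega>'_def)
    have W'_sub: "revealed \<omega>' b \<subseteq> W \<union> T"
    proof
      fix q assume "q \<in> revealed \<omega>' b"
      then obtain u v where q: "q = (u, v)" "u \<in> U" "\<omega>' u = (b, v)" by (auto simp: revealed_def)
      show "q \<in> W \<union> T"
      proof (cases "u \<in> fst ` T")
        case True
        then obtain v' where v': "(u, v') \<in> T" by auto
        have "\<omega>' u = (b, v')" unfolding \<omega>'_def by (rule overwrite_mem[OF Ts xA v'])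
        then show ?thesis using q v' by auto
      next
        case False
        then show ?thesis using q by (auto simp: \<omega>'_def overwrite_def W_def revealed_def)
      qed
    qed
    have x'_rev: "g \<omega>' x' \<subseteq> revealed \<omega>' b"
    proof
      fix q assume "q \<in> g \<omega>' x'"
      then have qg: "q \<in> g \<omega> x'" by (simp add: same)
      obtain u v where q: "q = (u, v)" by (cases q)
      have uU: "u \<in> U" using qg gx' s_dom[OF x'A] q by force
      show "q \<in> revealed \<omega>' b"
      proof (cases "q \<in> T")
        case True
        then show ?thesis using overwrite_mem[OF Ts xA, of u v b \<omega>] q uU by (auto simp: revealed_def \<omega>'_def)
      next
        case False
        then have qW: "q \<in> W" using qg x' by auto
        \<comment> \<open>If \<open>T\<close> had overwritten \<open>u\<close>, both bits would come
          from the partial function \<open>s x'\<close> and agree, putting \<open>q\<close> into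
          \<open>T\<close>.\<close>
        have "u \<notin> fst ` T"
        proof
          assume "u \<in> fst ` T"
          then obtain v' where v': "(u, v') \<in> T" by auto
          then have "(u, v') \<in> s x'" "(u, v) \<in> s x'" using x' gx' qg q by auto
          then have "v = v'" using s_functional[OF x'A] by blast
          then show False using v' False q by auto
        qed
        then show ?thesis using qW q by (auto simp: revealed_def W_def \<omega>'_def overwrite_def)
      qed
    qed
    have \<omega>'\<Omega>: "\<omega>' \<in> \<Omega>" unfolding \<Omega>_def using \<omega>'S x'_rev x'(1) same by auto
    define z where "z = core \<omega>'"
    have z: "z \<in> C \<omega>" "g \<omega> z \<subseteq> revealed \<omega>' b" using core[OF \<omega>'\<Omega>] same by (auto simp: z_def)
    \<comment> \<open>The core \<open>z\<close> is revealed by \<open>W \<union> T\<close>, so its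
      residue competes in the minimum defining \<open>T\<close>; contained in \<open>T\<close> and
      no smaller, it equals \<open>T\<close>.\<close>
    have zT: "g \<omega> z - W \<subseteq> T" using z W'_sub by blast
    have "card T \<le> card (g \<omega> z - W)"
      unfolding T_def by (rule fragment_minimal) (use z zT Tx in auto)
    moreover have "finite T" using Ts finite_s[OF xA] finite_subset by blast
    ultimately have "g \<omega> z - W = T" using zT by (meson card_seteq)
    then have "T \<in> \<T> \<omega>'" unfolding \<T>_def using same cT by (auto simp: z_def)
    moreover have "(x, \<omega>) \<in> E \<omega>' T"
      unfolding E_def using xA Ts \<omega> by (auto simp: \<omega>'_def overwrite_def)
    ultimately show "p \<in> (\<Union>\<omega>\<in>\<Omega>. \<Union>T\<in>\<T> \<omega>. E \<omega> T)" using \<omega>'\<Omega> p_eq by blast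
  qed
  moreover have "finite (\<Union>\<omega>\<in>\<Omega>. \<Union>T\<in>\<T> \<omega>. E \<omega> T)"
    using fin\<Omega> fin\<T> finite_A finite_states by (auto simp: E_def)
  ultimately have "card ?B \<le> card (\<Union>\<omega>\<in>\<Omega>. \<Union>T\<in>\<T> \<omega>. E \<omega> T)" by (rule card_mono[rotated])
  also have "\<dots> \<le> (\<Sum>\<omega>\<in>\<Omega>. card (\<Union>T\<in>\<T> \<omega>. E \<omega> T))" by (rule card_UN_le[OF fin\<Omega>])
  also have "\<dots> \<le> (\<Sum>\<omega>\<in>\<Omega>. \<Sum>T\<in>\<T> \<omega>. card (E \<omega> T))" by (intro sum_mono card_UN_le fin\<T>)
  finally have "real (card ?B) \<le> real (\<Sum>\<omega>\<in>\<Omega>. \<Sum>T\<in>\<T> \<omega>. card (E \<omega> T))" by linarith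
  then have "real (card ?B) * \<kappa> ^ i \<le> real (\<Sum>\<omega>\<in>\<Omega>. \<Sum>T\<in>\<T> \<omega>. card (E \<omega> T)) * \<kappa> ^ i"
    using \<kappa>_pos by (intro mult_right_mono) auto
  also have "\<dots> = (\<Sum>\<omega>\<in>\<Omega>. \<Sum>T\<in>\<T> \<omega>. real (card (E \<omega> T)) * \<kappa> ^ i)"
    by (simp add: sum_distrib_right)
  also have "\<dots> \<le> (\<Sum>\<omega>\<in>\<Omega>. \<Sum>T\<in>\<T> \<omega>. 2 * real (card A) * real (2 * K) ^ i)"
  proof (intro sum_mono)
    fix \<omega> T assume \<omega>: "\<omega> \<in> \<Omega>" and T: "T \<in> \<T> \<omega>"
    have Tc: "T \<subseteq> s (core \<omega>)" "card T = i" using T core_fin[OF \<omega>] by (auto simp: \<T>_def)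
    have fT: "finite T" using Tc core_fin[OF \<omega>] finite_s finite_subset by blast
    have cfst: "card (fst ` T) = i"
      using card_image[OF inj_on_subset[OF s_inj[OF core_fin(3)[OF \<omega>]] Tc(1)]] Tc by simp
    have "fst ` T \<subseteq> U" using Tc s_dom[OF core_fin(3)[OF \<omega>]] by blast
    from card_states_agreeing[OF this, of K \<omega>] cfst
    have 1: "card {\<omega>1 \<in> states K. \<forall>u. u \<notin> fst ` T \<longrightarrow> \<omega>1 u = \<omega> u} \<le> (2 * K) ^ i" by simp
    \<comment> \<open>Spreadness pays for the choice of \<open>x\<close>, the factor
      \<open>(2 * K) ^ i\<close> for the values lost under \<open>T\<close>.\<close>
    have "real (card (E \<omega> T)) * \<kappa> ^ i =
      (real (card {x \<in> A. T \<subseteq> s x}) * \<kappa> ^ card T) * real (card {\<omega>1 \<in> states K. \<forall>u. u \<notin> fst ` T \<longrightarrow> \<omega>1 u = \<omega> u})"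
      by (simp add: E_def card_cartesian_product Tc)
    also have "\<dots> \<le> (2 * real (card A)) * real ((2 * K) ^ i)"
      by (rule mult_mono[OF spread[OF fT] of_nat_mono[OF 1]]) auto
    finally show "real (card (E \<omega> T)) * \<kappa> ^ i \<le> 2 * real (card A) * real (2 * K) ^ i" by simp
  qed
  also have "\<dots> = (\<Sum>\<omega>\<in>\<Omega>. real (card (\<T> \<omega>)) * (2 * real (card A) * real (2 * K) ^ i))" by simp
  also have "\<dots> \<le> (\<Sum>\<omega>\<in>\<Omega>. real (r choose i) * (2 * real (card A) * real (2 * K) ^ i))"
  proof (intro sum_mono mult_right_mono)
    fix \<omega> assume \<omega>: "\<omega> \<in> \<Omega>"
    have "card (\<T> \<omega>) = card (g \<omega> (core \<omega>)) choose i"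
      unfolding \<T>_def by (rule n_subsets) (use core_fin[OF \<omega>] in auto)
    also have "\<dots> \<le> r choose i" using core_fin[OF \<omega>] by (intro binomial_right_mono)
    finally show "real (card (\<T> \<omega>)) \<le> real (r choose i)" by simp
  qed auto
  also have "\<dots> = real (card \<Omega>) * (real (r choose i) * (2 * real (card A) * real (2 * K) ^ i))" by simp
  also have "\<dots> \<le> real (card (states K)) * (real (r choose i) * (2 * real (card A) * real (2 * K) ^ i))"
    using card_mono[OF finite_states \<Omega>_sub] by (intro mult_right_mono) auto
  finally show ?thesis by (simp add: algebra_simps)
qed

text \<open>The \<open>2 * K\<close> possible values at \<open>u\<close> are equally likely. The
  bound is multiplied out to stay in \<open>nat\<close>, and it is an inequality because
  \<open>q\<close> may fail to be a legal value.\<close>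

lemma card_states_fixed:
  assumes "u \<in> U"
  shows "card {\<omega> \<in> states K. \<omega> u = q} * (2 * K) \<le> card (states K)"
proof -
  have "card {\<omega> \<in> states K. \<omega> u = q}
      \<le> card {\<omega> \<in> states K. \<forall>u'. u' \<notin> U - {u} \<longrightarrow> \<omega> u' = (if u' = u then q else undefined)}"
  proof (rule card_mono)
    show "finite {\<omega> \<in> states K. \<forall>u'. u' \<notin> U - {u} \<longrightarrow> \<omega> u' = (if u' = u then q else undefined)}"
      using finite_states by simp
    show "{\<omega> \<in> states K. \<omega> u = q}
        \<subseteq> {\<omega> \<in> states K. \<forall>u'. u' \<notin> U - {u} \<longrightarrow> \<omega> u' = (if u' = u then q else undefined)}"
      by (auto simp: states_def PiE_iff extensional_def)
  qed
  also have "\<dots> \<le> (2 * K) ^ card (U - {u})" by (rule card_states_agreeing) auto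
  finally have "card {\<omega> \<in> states K. \<omega> u = q} * (2 * K) \<le> (2 * K) ^ card (U - {u}) * (2 * K)"
    by (rule mult_right_mono) simp
  also have "\<dots> = (2 * K) ^ Suc (card (U - {u}))" by simp
  also have "Suc (card (U - {u})) = card U" using assms finite_U by (simp only: card_Suc_Diff1)
  finally show ?thesis by (simp add: card_states)
qed

text \<open>Union bound over the at most \<open>n\<close> elements of \<open>s x\<close>: a given
  wrong bit in a given colour has probability at most \<open>1 / (2 * K)\<close>.\<close>

lemma card_clashing:
  "card (clashing K a) * (2 * K) \<le> n * (card (states K) * card A)"
proof -
  let ?E = "\<lambda>x q. {x} \<times> {\<omega> \<in> states K. \<omega> (fst q) = (a, \<not> snd q)}"
  have "clashing K a \<subseteq> (\<Union>x\<in>A. \<Union>q\<in>s x. ?E x q)"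
  proof
    fix p assume "p \<in> clashing K a"
    then obtain x \<omega> u v where "p = (x, \<omega>)" "x \<in> A" "\<omega> \<in> states K" "(u, v) \<in> s x" "\<omega> u = (a, \<not> v)"
      by (auto simp: clashing_def)
    then have "p \<in> ?E x (u, v)" by simp
    with \<open>x \<in> A\<close> \<open>(u, v) \<in> s x\<close> show "p \<in> (\<Union>x\<in>A. \<Union>q\<in>s x. ?E x q)" by blast
  qed
  moreover have "finite (\<Union>x\<in>A. \<Union>q\<in>s x. ?E x q)"
    using finite_A finite_s finite_states by auto
  ultimately have "card (clashing K a) \<le> card (\<Union>x\<in>A. \<Union>q\<in>s x. ?E x q)" by (rule card_mono[rotated])
  also have "\<dots> \<le> (\<Sum>x\<in>A. card (\<Union>q\<in>s x. ?E x q))" by (rule card_UN_le[OF finite_A])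
  also have "\<dots> \<le> (\<Sum>x\<in>A. \<Sum>q\<in>s x. card (?E x q))" by (intro sum_mono card_UN_le finite_s)
  finally have "card (clashing K a) * (2 * K) \<le> (\<Sum>x\<in>A. \<Sum>q\<in>s x. card (?E x q)) * (2 * K)"
    by (rule mult_right_mono) simp
  also have "\<dots> = (\<Sum>x\<in>A. \<Sum>q\<in>s x. card {\<omega> \<in> states K. \<omega> (fst q) = (a, \<not> snd q)} * (2 * K))"
    by (simp only: sum_distrib_right card_cartesian_product_singleton)
  also have "\<dots> \<le> (\<Sum>x\<in>A. \<Sum>q\<in>s x. card (states K))"
    by (intro sum_mono card_states_fixed) (use s_dom in blast)
  also have "\<dots> \<le> (\<Sum>x\<in>A. n * card (states K))"
    by (intro sum_mono) (simp add: s_card)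
  finally show ?thesis by (simp add: mult.commute mult.left_commute)
qed

text \<open>
  Two rounds: colour \<open>a\<close> leaves fragments of size at most \<open>R\<close>, among which colour \<open>b\<close> then completes one.
  A single round (equivalently, Janson's inequality) would need \<open>\<kappa>\<close> larger by a factor of order \<open>n\<close>
  divided by \<open>R\<close>, which the hypothesis on \<open>m\<close> just fails to give.
\<close>

lemma card_failing:
  fixes a b K R :: nat
  assumes ab: "a < K" "b < K" "a \<noteq> b"
  defines "\<eta> \<equiv> real (2 * K) / \<kappa>"
  shows "real (card (failing K a b)) \<le>
    (real n / real (2 * K) + 2 * (\<Sum>i=Suc R..n. real (n choose i) * \<eta> ^ i)
      + 2 * (\<Sum>i=1..R. real (R choose i) * \<eta> ^ i)) * real (card (states K))"
proof -
  define N where "N = real (card (states K)) * real (card A)"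
  \<comment> \<open>Colour \<open>a\<close> leaves the fragments \<open>g1\<close>, and
    \<open>C2\<close> keeps the members whose fragment is short. \<open>B1\<close> and
    \<open>B2\<close> sort pairs by fragment size in the first and in the second round.\<close>
  define g1 where "g1 \<omega> = fragment A s (revealed \<omega> a)" for \<omega>
  define C2 where "C2 \<omega> = {x \<in> A. card (g1 \<omega> x) \<le> R}" for \<omega>
  define B1 where "B1 i = {p \<in> A \<times> states K. card (fragment A s (revealed (snd p) a) (fst p)) = i}" for i
  define H2 where "H2 = {(x, \<omega>). \<omega> \<in> states K \<and> x \<in> C2 \<omega> \<and> (x, \<omega>) \<notin> clashing K a}"
  define B2 where "B2 i = {p \<in> H2. card (fragment (C2 (snd p)) (g1 (snd p)) (revealed (snd p) b) (fst p)) = i}" for i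
  have K: "0 < K" using ab by simp
  have finAS: "finite (A \<times> states K)" using finite_A finite_states by auto
  have scale: "real (card B) \<le> 2 * (real (r choose i) * \<eta> ^ i) * N"
    if "real (card B) * \<kappa> ^ i \<le> 2 * real (r choose i) * real (2 * K) ^ i * N" for B :: "('a \<times> ('u \<Rightarrow> nat \<times> bool)) set" and r i
  proof -
    have "real (card B) \<le> (2 * real (r choose i) * real (2 * K) ^ i * N) / \<kappa> ^ i"
      using that \<kappa>_pos by (simp add: pos_le_divide_eq)
    then show ?thesis by (simp add: \<eta>_def power_divide field_simps)
  qed
  have g1_sub: "g1 \<omega> x \<subseteq> s x" if "x \<in> A" for \<omega> x
    unfolding g1_def by (rule fragment_origin(2)[OF that])
  have g1_le: "card (g1 \<omega> x) \<le> n" if "x \<in> A" for \<omega> x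
    using card_mono[OF finite_s[OF that] g1_sub[OF that]] s_card[OF that] le_trans by blast
  have b1: "real (card (B1 i)) \<le> 2 * (real (n choose i) * \<eta> ^ i) * N" for i
  proof (rule scale)
    show "real (card (B1 i)) * \<kappa> ^ i \<le> 2 * real (n choose i) * real (2 * K) ^ i * N"
      unfolding B1_def N_def
      by (rule card_fragment_eq_le[where C = "\<lambda>_. A" and g = "\<lambda>_. s"]) (use ab s_card in auto)
  qed
  have b2: "real (card (B2 i)) \<le> 2 * (real (R choose i) * \<eta> ^ i) * N" for i
  proof (rule scale)
    show "real (card (B2 i)) * \<kappa> ^ i \<le> 2 * real (R choose i) * real (2 * K) ^ i * N"
      unfolding B2_def N_def
    proof (rule card_fragment_eq_le[OF ab(2)])
      fix \<omega> x assume "\<omega> \<in> states K" "x \<in> C2 \<omega>"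
      then show "x \<in> A \<and> g1 \<omega> x \<subseteq> s x \<and> card (g1 \<omega> x) \<le> R" using g1_sub by (auto simp: C2_def)
    next
      fix \<omega> x T assume xH: "(x, \<omega>) \<in> H2" and T: "T \<subseteq> g1 \<omega> x"
      have \<omega>: "\<omega> \<in> states K" and xA: "x \<in> A" and noclash: "\<And>u v. (u, v) \<in> s x \<Longrightarrow> \<omega> u \<noteq> (a, \<not> v)"
        using xH by (auto simp: H2_def C2_def clashing_def)
      have Ts: "T \<subseteq> s x" using T g1_sub[OF xA] by blast
      \<comment> \<open>A fragment avoids \<open>revealed \<omega> a\<close>, which rules out the
        right bit in colour \<open>a\<close>; the absence of clashes rules out the wrong one. Hence
        \<open>T\<close> touches nothing of colour \<open>a\<close>.\<close>
      have Tdisj: "T \<inter> revealed \<omega> a = {}"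
        using T fragment_origin(1)[OF xA, of s "revealed \<omega> a"] by (auto simp: g1_def)
      have "revealed (overwrite b T \<omega>) a = revealed \<omega> a"
      proof -
        have "overwrite b T \<omega> u = (a, v) \<longleftrightarrow> \<omega> u = (a, v)" if u: "u \<in> U" for u v
        proof (cases "u \<in> fst ` T")
          case True
          then obtain v' where v': "(u, v') \<in> T" by auto
          have "overwrite b T \<omega> u = (b, v')" by (rule overwrite_mem[OF Ts xA v'])
          moreover have "\<omega> u \<noteq> (a, v')" using Tdisj v' u by (auto simp: revealed_def)
          moreover have "\<omega> u \<noteq> (a, \<not> v')" using noclash v' Ts by blast
          ultimately show ?thesis using ab by (cases v; cases v') auto
        qed (simp add: overwrite_def)
        then show ?thesis by (auto simp: revealed_def)
      qed
      then have "g1 (overwrite b T \<omega>) = g1 \<omega>" by (simp add: g1_def)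
      then show "C2 (overwrite b T \<omega>) = C2 \<omega> \<and> g1 (overwrite b T \<omega>) = g1 \<omega>" by (simp add: C2_def)
    qed (auto simp: H2_def)
  qed
  have "A \<times> failing K a b \<subseteq> clashing K a \<union> (\<Union>i\<in>{Suc R..n}. B1 i) \<union> (\<Union>i\<in>{1..R}. B2 i)"
  proof
    fix p assume p: "p \<in> A \<times> failing K a b"
    obtain x \<omega> where p_eq: "p = (x, \<omega>)" by (cases p)
    have xA: "x \<in> A" and \<omega>: "\<omega> \<in> states K"
      and fl: "\<not> (\<exists>x\<in>A. s x \<subseteq> revealed \<omega> a \<union> revealed \<omega> b)"
      using p p_eq by (auto simp: failing_def)
    show "p \<in> clashing K a \<union> (\<Union>i\<in>{Suc R..n}. B1 i) \<union> (\<Union>i\<in>{1..R}. B2 i)"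
    proof (cases "p \<in> clashing K a")
      case noclash: False
      show ?thesis
      proof (cases "card (g1 \<omega> x) \<le> R")
        case False
        then have "p \<in> B1 (card (g1 \<omega> x))" "card (g1 \<omega> x) \<in> {Suc R..n}"
          using g1_le[OF xA] xA \<omega> p_eq by (auto simp: B1_def g1_def)
        then show ?thesis by blast
      next
        case True
        then have xC: "x \<in> C2 \<omega>" using xA by (simp add: C2_def)
        define T where "T = fragment (C2 \<omega>) (g1 \<omega>) (revealed \<omega> b) x"
        from fragment_origin(1)[OF xC, of "g1 \<omega>" "revealed \<omega> b"] obtain x' where
          x': "x' \<in> C2 \<omega>" "T = g1 \<omega> x' - revealed \<omega> b" unfolding T_def by blast
        have T: "T \<subseteq> g1 \<omega> x" unfolding T_def by (rule fragment_origin(2)[OF xC])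
        have finT: "finite T" by (rule finite_subset[OF order_trans[OF T g1_sub[OF xA]] finite_s[OF xA]])
        have cT: "card T \<le> R"
          using card_mono[of "g1 \<omega> x" T] T True finite_subset[OF g1_sub[OF xA] finite_s[OF xA]] by simp
        \<comment> \<open>An empty second fragment would mean that colour \<open>b\<close> reveals a
          whole residue of the first round, so that the two colours together reveal a
          member.\<close>
        have "T \<noteq> {}"
        proof
          assume "T = {}"
          then have "g1 \<omega> x' \<subseteq> revealed \<omega> b" using x' by auto
          moreover have "x' \<in> A" using x' by (simp add: C2_def)
          then obtain x'' where "x'' \<in> A" "g1 \<omega> x' = s x'' - revealed \<omega> a"
            using fragment_origin(1)[of x' A s "revealed \<omega> a"] by (auto simp: g1_def)
          ultimately have "s x'' \<subseteq> revealed \<omega> a \<union> revealed \<omega> b" by auto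
          then show False using fl \<open>x'' \<in> A\<close> by blast
        qed
        then have "card T \<in> {1..R}" using cT finT by (simp add: Suc_le_eq card_gt_0_iff)
        moreover have "p \<in> B2 (card T)" using noclash \<omega> xC p_eq by (simp add: B2_def H2_def T_def)
        ultimately show ?thesis by blast
      qed
    qed auto
  qed
  moreover have "finite (clashing K a)" "finite (B1 i)" "finite (B2 i)" for i
    by (rule finite_subset[OF _ finAS], force simp: clashing_def B1_def B2_def H2_def C2_def)+
  ultimately have "card (A \<times> failing K a b)
      \<le> card (clashing K a \<union> (\<Union>i\<in>{Suc R..n}. B1 i) \<union> (\<Union>i\<in>{1..R}. B2 i))"
    by (intro card_mono finite_UnI finite_UN_I finite_atLeastAtMost)
  also have "\<dots> \<le> card (clashing K a) + card (\<Union>i\<in>{Suc R..n}. B1 i) + card (\<Union>i\<in>{1..R}. B2 i)"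
    by (rule le_trans[OF card_Un_le add_right_mono[OF card_Un_le]])
  also have "\<dots> \<le> card (clashing K a) + (\<Sum>i=Suc R..n. card (B1 i)) + (\<Sum>i=1..R. card (B2 i))"
    by (intro add_mono card_UN_le finite_atLeastAtMost order_refl)
  finally have "real (card (A \<times> failing K a b)) \<le>
      real (card (clashing K a) + (\<Sum>i=Suc R..n. card (B1 i)) + (\<Sum>i=1..R. card (B2 i)))"
    by (simp only: of_nat_le_iff)
  then have "real (card A) * real (card (failing K a b)) \<le>
      real (card (clashing K a)) + (\<Sum>i=Suc R..n. real (card (B1 i))) + (\<Sum>i=1..R. real (card (B2 i)))"
    by (simp only: card_cartesian_product of_nat_mult of_nat_add of_nat_sum)
  also have "\<dots> \<le> real n / real (2 * K) * N + (\<Sum>i=Suc R..n. 2 * (real (n choose i) * \<eta> ^ i) * N)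
      + (\<Sum>i=1..R. 2 * (real (R choose i) * \<eta> ^ i) * N)"
  proof (intro add_mono sum_mono b1 b2)
    have "real (card (clashing K a) * (2 * K)) \<le> real (n * (card (states K) * card A))"
      using card_clashing by (simp only: of_nat_le_iff)
    then have "real (card (clashing K a)) * real (2 * K) \<le> real n * N" by (simp add: N_def)
    then show "real (card (clashing K a)) \<le> real n / real (2 * K) * N"
      using K by (simp add: field_simps)
  qed
  also have "\<dots> = real (card A) * ((real n / real (2 * K) + 2 * (\<Sum>i=Suc R..n. real (n choose i) * \<eta> ^ i)
      + 2 * (\<Sum>i=1..R. real (R choose i) * \<eta> ^ i)) * real (card (states K)))"
    by (simp add: N_def algebra_simps sum_distrib_left sum_distrib_right)
  finally show ?thesis
    using A_ne finite_A by (simp add: card_gt_0_iff)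
qed

text \<open>
  A random colouring of \<open>U\<close> with \<open>2 * T\<close> colours splits \<open>y\<close> into \<open>T\<close> trials that are independent once
  the colouring is fixed; some colouring has average failure probability at most one half.
\<close>

lemma card_missed:
  assumes fail: "\<And>a b. a < 2 * T \<Longrightarrow> b < 2 * T \<Longrightarrow> a \<noteq> b \<Longrightarrow>
      real (card (failing (2 * T) a b)) \<le> 1 / 2 * real (card (states (2 * T)))"
  shows "real (card missed) \<le> (1 / 2) ^ T * 2 ^ card U"
proof (cases "T = 0")
  \<comment> \<open>With no colours the set of colourings may be empty, so the averaging below needs
    \<open>T\<close> positive.\<close>
  case True
  have "card missed \<le> card (U \<rightarrow>\<^sub>E (UNIV :: bool set))"
    unfolding missed_def using finite_U by (intro card_mono finite_PiE) auto
  also have "\<dots> = 2 ^ card U" using finite_U by (simp add: card_PiE)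
  finally show ?thesis using True by simp
next
  case T: False
  define Cs where "Cs = (U \<rightarrow>\<^sub>E {..<2 * T})"
  define Ys where "Ys = (U \<rightarrow>\<^sub>E (UNIV :: bool set))"
  \<comment> \<open>Trial \<open>t\<close> owns the two colours \<open>2 * t\<close> and
    \<open>2 * t + 1\<close>, hence the test \<open>c u div 2 = t\<close>.\<close>
  define fl where "fl c t = {y \<in> Ys. \<not> (\<exists>x\<in>A. \<forall>(u, v)\<in>s x. c u div 2 = t \<and> y u = v)}" for c :: "'u \<Rightarrow> nat" and t
  have finC: "finite Cs" and finY: "finite Ys" unfolding Cs_def Ys_def using finite_U by (auto intro: finite_PiE)
  have finF: "finite (fl c t)" for c t using finY by (simp add: fl_def)
  have cardY: "card Ys = 2 ^ card U" using finite_U by (simp add: Ys_def card_PiE)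
  have cardCY: "card (states (2 * T)) = card Cs * card Ys"
    using finite_U power_mult_distrib[of "2 * T" 2 "card U"]
    by (simp add: card_states cardY Cs_def card_PiE mult.commute)
  have Cs_ne: "Cs \<noteq> {}" using T by (auto simp: Cs_def PiE_eq_empty_iff lessThan_empty_iff)
  have trial: "(\<Sum>c\<in>Cs. card (fl c t)) \<le> card (failing (2 * T) (2 * t) (2 * t + 1))" if "t < T" for t
  proof -
    have "card (SIGMA c:Cs. fl c t) \<le> card (failing (2 * T) (2 * t) (2 * t + 1))"
    proof (rule card_inj_on_le[where f = "\<lambda>(c, y). \<lambda>u\<in>U. (c u, y u)"])
      show "inj_on (\<lambda>(c, y). \<lambda>u\<in>U. (c u, y u)) (SIGMA c:Cs. fl c t)"
      proof (rule inj_onI)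
        fix p q assume p: "p \<in> (SIGMA c:Cs. fl c t)" and q: "q \<in> (SIGMA c:Cs. fl c t)"
          and eq: "(\<lambda>(c, y). \<lambda>u\<in>U. (c u, y u)) p = (\<lambda>(c, y). \<lambda>u\<in>U. (c u, y u)) q"
        obtain c y c' y' where pq: "p = (c, y)" "q = (c', y')" by (cases p; cases q)
        have e: "c u = c' u \<and> y u = y' u" if "u \<in> U" for u
          using fun_cong[OF eq, of u] that by (simp add: pq)
        have "c = c'" using p q e by (intro PiE_ext[of c U "\<lambda>_. {..<2 * T}" c']) (auto simp: pq Cs_def)
        moreover have "y = y'" using p q e by (intro PiE_ext[of y U "\<lambda>_. UNIV" y']) (auto simp: pq fl_def Ys_def)
        ultimately show "p = q" by (simp add: pq)
      qed
      show "(\<lambda>(c, y). \<lambda>u\<in>U. (c u, y u)) ` (SIGMA c:Cs. fl c t) \<subseteq> failing (2 * T) (2 * t) (2 * t + 1)"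
      proof (rule image_subsetI)
        fix p assume "p \<in> (SIGMA c:Cs. fl c t)"
        then obtain c y where p: "p = (c, y)" and c: "c \<in> Cs" and y: "y \<in> fl c t" by blast
        define \<omega> where "\<omega> = (\<lambda>u\<in>U. (c u, y u))"
        have "\<omega> \<in> states (2 * T)" using c by (auto simp: \<omega>_def states_def Cs_def PiE_iff)
        moreover have "\<not> s x \<subseteq> revealed \<omega> (2 * t) \<union> revealed \<omega> (2 * t + 1)" if "x \<in> A" for x
        proof
          assume sub: "s x \<subseteq> revealed \<omega> (2 * t) \<union> revealed \<omega> (2 * t + 1)"
          have "\<forall>(u, v)\<in>s x. c u div 2 = t \<and> y u = v"
            using sub by (fastforce simp: revealed_def \<omega>_def)
          then show False using y that by (auto simp: fl_def)
        qed
        ultimately show "(\<lambda>(c, y). \<lambda>u\<in>U. (c u, y u)) p \<in> failing (2 * T) (2 * t) (2 * t + 1)"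
          by (simp add: p failing_def flip: \<omega>_def)
      qed
      show "finite (failing (2 * T) (2 * t) (2 * t + 1))" using finite_states by (simp add: failing_def)
    qed
    then show ?thesis using finC finF by (simp add: card_SigmaI)
  qed
  obtain c where c: "c \<in> Cs" and avg: "(\<Sum>t<T. real (card (fl c t))) \<le> real T / 2 * real (card Ys)"
  proof (rule ccontr)
    assume "\<not> thesis"
    with that have "\<And>c. c \<in> Cs \<Longrightarrow> real T / 2 * real (card Ys) < (\<Sum>t<T. real (card (fl c t)))" by force
    then have "(\<Sum>c\<in>Cs. real T / 2 * real (card Ys)) < (\<Sum>c\<in>Cs. \<Sum>t<T. real (card (fl c t)))"
      using finC Cs_ne by (intro sum_strict_mono) auto
    also have "\<dots> = (\<Sum>t<T. real (\<Sum>c\<in>Cs. card (fl c t)))"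
      by (subst sum.swap) simp
    also have "\<dots> \<le> (\<Sum>t<T. 1 / 2 * real (card (states (2 * T))))"
    proof (intro sum_mono)
      fix t assume "t \<in> {..<T}"
      then have t: "t < T" by simp
      have "real (\<Sum>c\<in>Cs. card (fl c t)) \<le> real (card (failing (2 * T) (2 * t) (2 * t + 1)))"
        using trial[OF t] by (simp only: of_nat_le_iff)
      also have "\<dots> \<le> 1 / 2 * real (card (states (2 * T)))" using t by (intro fail) auto
      finally show "real (\<Sum>c\<in>Cs. card (fl c t)) \<le> 1 / 2 * real (card (states (2 * T)))" .
    qed
    finally show False by (simp add: cardCY)
  qed
  define V where "V t = {u \<in> U. c u div 2 = t}" for t
  \<comment> \<open>Failure of trial \<open>t\<close> seen on its own block \<open>V t\<close>. For
    fixed \<open>c\<close> the blocks partition \<open>U\<close>, which is the source of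
    independence.\<close>
  define Gs where "Gs t = {y \<in> V t \<rightarrow>\<^sub>E UNIV. \<not> (\<exists>x\<in>A. \<forall>(u, v)\<in>s x. u \<in> V t \<and> y u = v)}" for t
  have V_sub: "V t \<subseteq> U" for t by (auto simp: V_def)
  have finV: "finite (V t)" for t using finite_subset[OF V_sub finite_U] .
  have finG: "finite (Gs t)" for t unfolding Gs_def using finV finite_PiE[of "V t" "\<lambda>_. UNIV :: bool set"] by simp
  have VT: "c u div 2 < T" if "u \<in> U" for u
    using c that by (auto simp: Cs_def PiE_iff less_mult_imp_div_less mult.commute)
  \<comment> \<open>A failing pattern on \<open>V t\<close> stays failing under every assignment of
    the other coordinates.\<close>
  have G_fl: "card (Gs t) * 2 ^ card (U - V t) \<le> card (fl c t)" for t
  proof -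
    let ?m = "\<lambda>(y, y'). \<lambda>u\<in>U. if u \<in> V t then y u else y' u :: bool"
    have "card (Gs t \<times> ((U - V t) \<rightarrow>\<^sub>E (UNIV :: bool set))) \<le> card (fl c t)"
    proof (rule card_inj_on_le[where f = ?m])
      show "inj_on ?m (Gs t \<times> ((U - V t) \<rightarrow>\<^sub>E UNIV))"
      proof (rule inj_onI)
        fix p q assume p: "p \<in> Gs t \<times> ((U - V t) \<rightarrow>\<^sub>E UNIV)" and q: "q \<in> Gs t \<times> ((U - V t) \<rightarrow>\<^sub>E UNIV)"
          and eq: "?m p = ?m q"
        obtain y z y' z' where pq: "p = (y, z)" "q = (y', z')" by (cases p; cases q)
        have 1: "y u = y' u" if "u \<in> V t" for u
          using fun_cong[OF eq, of u] that subsetD[OF V_sub that] by (simp add: pq)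
        have 2: "z u = z' u" if "u \<in> U - V t" for u
          using fun_cong[OF eq, of u] that by (auto simp: pq)
        have "y = y'" using p q 1 by (intro PiE_ext[of y "V t" "\<lambda>_. UNIV" y']) (auto simp: pq Gs_def)
        moreover have "z = z'" using p q 2 by (intro PiE_ext[of z "U - V t" "\<lambda>_. UNIV" z']) (auto simp: pq)
        ultimately show "p = q" by (simp add: pq)
      qed
      show "?m ` (Gs t \<times> ((U - V t) \<rightarrow>\<^sub>E UNIV)) \<subseteq> fl c t"
      proof (rule image_subsetI)
        fix p assume "p \<in> Gs t \<times> ((U - V t) \<rightarrow>\<^sub>E (UNIV :: bool set))"
        then obtain y z where p: "p = (y, z)" and y: "y \<in> Gs t" by auto
        have "\<not> (\<forall>(u, v)\<in>s x. c u div 2 = t \<and> ?m p u = v)" if x: "x \<in> A" for x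
        proof
          assume *: "\<forall>(u, v)\<in>s x. c u div 2 = t \<and> ?m p u = v"
          have "u \<in> V t \<and> y u = v" if "(u, v) \<in> s x" for u v
          proof -
            have "u \<in> U" using s_dom[OF x] that by force
            then show ?thesis using bspec[OF * that] by (auto simp: V_def p)
          qed
          then have "\<forall>(u, v)\<in>s x. u \<in> V t \<and> y u = v" by auto
          then show False using y x unfolding Gs_def by blast
        qed
        moreover have "?m p \<in> Ys" by (auto simp: Ys_def p)
        ultimately show "?m p \<in> fl c t" unfolding fl_def by blast
      qed
    qed (rule finF)
    then show ?thesis using finite_U by (simp add: card_cartesian_product card_PiE)
  qed
  \<comment> \<open>A missed \<open>y\<close> fails in every trial and is determined by its
    restrictions to the blocks.\<close>
  have "card missed \<le> card (Pi\<^sub>E {..<T} Gs)"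
  proof (rule card_inj_on_le[where f = "\<lambda>y. \<lambda>t\<in>{..<T}. restrict y (V t)"])
    show "inj_on (\<lambda>y. \<lambda>t\<in>{..<T}. restrict y (V t)) missed"
    proof (rule inj_onI)
      fix y y' assume y: "y \<in> missed" "y' \<in> missed"
        and eq: "(\<lambda>t\<in>{..<T}. restrict y (V t)) = (\<lambda>t\<in>{..<T}. restrict y' (V t))"
      have "y u = y' u" if u: "u \<in> U" for u
        using fun_cong[OF fun_cong[OF eq, of "c u div 2"], of u] VT[OF u] u by (simp add: V_def)
      then show "y = y'" using y by (intro PiE_ext[of y U "\<lambda>_. UNIV" y']) (auto simp: missed_def)
    qed
    show "(\<lambda>y. \<lambda>t\<in>{..<T}. restrict y (V t)) ` missed \<subseteq> Pi\<^sub>E {..<T} Gs"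
    proof (rule image_subsetI)
      fix y assume y: "y \<in> missed"
      have "restrict y (V t) \<in> Gs t" for t
      proof -
        have "\<not> (\<forall>(u, v)\<in>s x. u \<in> V t \<and> restrict y (V t) u = v)" if x: "x \<in> A" for x
        proof
          assume "\<forall>(u, v)\<in>s x. u \<in> V t \<and> restrict y (V t) u = v"
          then have "\<forall>(u, v)\<in>s x. y u = v" by auto
          then show False using y x unfolding missed_def by blast
        qed
        then show ?thesis unfolding Gs_def by auto
      qed
      then show "(\<lambda>t\<in>{..<T}. restrict y (V t)) \<in> Pi\<^sub>E {..<T} Gs" by simp
    qed
    show "finite (Pi\<^sub>E {..<T} Gs)" using finG by (intro finite_PiE) auto
  qed
  then have missed_le: "real (card missed) \<le> (\<Prod>t<T. real (card (Gs t)))"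
    by (simp add: card_PiE flip: of_nat_prod)
  define q where "q t = real (card (Gs t)) / 2 ^ card (V t)" for t
  have cUV: "card U = card (V t) + card (U - V t)" for t
    using card_Diff_subset[OF finV V_sub, of t] card_mono[OF finite_U V_sub, of t] by simp
  have q_le: "q t \<le> real (card (fl c t)) / real (card Ys)" for t
  proof -
    have "real (card (Gs t) * 2 ^ card (U - V t)) \<le> real (card (fl c t))"
      using G_fl by (simp only: of_nat_le_iff)
    then show ?thesis by (simp add: q_def cardY cUV[of t] power_add field_simps)
  qed
  have "(\<Sum>t<T. q t) \<le> (\<Sum>t<T. real (card (fl c t)) / real (card Ys))" by (intro sum_mono q_le)
  also have "\<dots> \<le> 1 / 2 * real (card {..<T})"
    using avg by (simp add: cardY field_simps flip: sum_divide_distrib)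
  \<comment> \<open>The failure rates average to at most one half, so AM-GM bounds their
    product.\<close>
  finally have "(\<Prod>t<T. q t) \<le> (1 / 2) ^ card {..<T}"
    by (intro prod_le_power_mean) (auto simp: q_def)
  then have q_prod: "(\<Prod>t<T. q t) \<le> (1 / 2) ^ T" by simp
  have "card U = card (\<Union>t\<in>{..<T}. V t)"
    by (rule arg_cong[where f = card]) (auto simp: V_def VT)
  also have "\<dots> = (\<Sum>t<T. card (V t))"
    by (rule card_UN_disjoint) (auto simp: finV, auto simp: V_def)
  finally have "(\<Prod>t<T. (2::real) ^ card (V t)) = 2 ^ card U" by (simp add: power_sum)
  then have "(\<Prod>t<T. real (card (Gs t))) = (\<Prod>t<T. q t) * 2 ^ card U"
    by (simp add: q_def prod_dividef)
  also have "\<dots> \<le> (1 / 2) ^ T * 2 ^ card U" using q_prod by (intro mult_right_mono) auto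
  finally show ?thesis using missed_le by linarith
qed

end

end

subsection \<open>Numerical estimates\<close>

text \<open>In the first tail each term is weighted by \<open>20 ^ i\<close>: the weighted sum is at
  most \<open>exp (sqrt n) \<le> 3 ^ Suc R\<close>, which leaves \<open>(3 / 20) ^ Suc R\<close>.
  The second sum is \<open>(1 + \<eta>) ^ R - 1\<close>, at most
  \<open>exp (1 / 20) - 1\<close>.\<close>

lemma binomial_tails_le:
  fixes \<eta> :: real and n :: nat
  assumes "0 \<le> \<eta>" and small: "\<eta> * sqrt (real n) \<le> 1 / 20"
  defines "R \<equiv> nat \<lfloor>sqrt (real n)\<rfloor>"
  shows "2 * (\<Sum>i=Suc R..n. real (n choose i) * \<eta> ^ i) + 2 * (\<Sum>i=1..R. real (R choose i) * \<eta> ^ i) \<le> 9 / 20"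
proof -
  have R: "real R \<le> sqrt (real n)" "sqrt (real n) \<le> real (Suc R)"
    unfolding R_def by (auto simp: of_nat_floor, linarith)
  have bin: "(\<Sum>i\<le>k. real (k choose i) * x ^ i) \<le> exp (x * real k)" if "0 \<le> x" for k and x :: real
  proof -
    have "(\<Sum>i\<le>k. real (k choose i) * x ^ i) = (1 + x) ^ k"
      using binomial_ring[of x 1 k] by (simp add: add.commute)
    also have "\<dots> \<le> exp x ^ k" using that by (intro power_mono exp_ge_add_one_self) auto
    finally show ?thesis by (simp add: mult.commute flip: exp_of_nat_mult)
  qed
  have "20 ^ Suc R * (\<Sum>i=Suc R..n. real (n choose i) * \<eta> ^ i)
      \<le> (\<Sum>i=Suc R..n. real (n choose i) * (20 * \<eta>) ^ i)"
    unfolding sum_distrib_left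
  proof (rule sum_mono)
    fix i assume "i \<in> {Suc R..n}"
    then have "(20::real) ^ Suc R \<le> 20 ^ i" by (intro power_increasing) auto
    then have "20 ^ Suc R * (real (n choose i) * \<eta> ^ i) \<le> 20 ^ i * (real (n choose i) * \<eta> ^ i)"
      using assms(1) by (intro mult_right_mono) auto
    then show "20 ^ Suc R * (real (n choose i) * \<eta> ^ i) \<le> real (n choose i) * (20 * \<eta>) ^ i"
      by (simp add: power_mult_distrib mult_ac)
  qed
  also have "\<dots> \<le> (\<Sum>i\<le>n. real (n choose i) * (20 * \<eta>) ^ i)"
    using assms(1) by (intro sum_mono2) auto
  also have "\<dots> \<le> exp (20 * \<eta> * real n)" using assms(1) by (intro bin) auto
  also have "20 * \<eta> * real n = 20 * (\<eta> * sqrt (real n)) * sqrt (real n)" by simp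
  also have "\<dots> \<le> 1 * sqrt (real n)" using small by (intro mult_right_mono) auto
  also have "exp (1 * sqrt (real n)) \<le> exp (real (Suc R) * 1)" using R by simp
  also have "\<dots> = exp 1 ^ Suc R" by (rule exp_of_nat_mult)
  also have "\<dots> \<le> 3 ^ Suc R" by (intro power_mono exp_le) auto
  finally have "20 ^ Suc R * (\<Sum>i=Suc R..n. real (n choose i) * \<eta> ^ i) \<le> 3 ^ Suc R" by simp
  then have "(\<Sum>i=Suc R..n. real (n choose i) * \<eta> ^ i) \<le> (3 / 20) ^ Suc R"
    by (simp add: power_divide field_simps)
  also have "\<dots> \<le> (3 / 20) ^ 1" by (rule power_decreasing) auto
  finally have 1: "(\<Sum>i=Suc R..n. real (n choose i) * \<eta> ^ i) \<le> 3 / 20" by simp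
  have "(\<Sum>i\<le>R. real (R choose i) * \<eta> ^ i) = 1 + (\<Sum>i=1..R. real (R choose i) * \<eta> ^ i)"
    by (simp add: atMost_atLeast0 sum.atLeast_Suc_atMost)
  moreover have "(\<Sum>i\<le>R. real (R choose i) * \<eta> ^ i) \<le> exp (\<eta> * real R)"
    using assms(1) by (intro bin)
  moreover have "exp (\<eta> * real R) \<le> exp (1 / 20)"
    using small mult_left_mono[OF R(1) assms(1)] by simp
  moreover have "exp (1 / 20 :: real) \<le> 43 / 40"
    by (rule order_trans[OF exp_bound]) (auto simp: power2_eq_square)
  ultimately have "(\<Sum>i=1..R. real (R choose i) * \<eta> ^ i) \<le> 3 / 40" by linarith
  then show ?thesis using 1 by linarith
qed

text \<open>Tangent line of the logarithm at 8, where \<open>log 2\<close> is the integer 3, applied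
  to \<open>r = sqrt t\<close>. The sign of \<open>r / 8 - 1\<close> decides whether the upper or
  the lower bound on \<open>ln 2\<close> is used.\<close>

lemma log2_le_sqrt:
  fixes t :: real
  assumes "49 \<le> t"
  shows "log 2 t \<le> 9 / 10 * sqrt t"
proof -
  define r where "r = sqrt t"
  have r: "7 \<le> r" using assms real_le_rsqrt[of 7 t] by (simp add: r_def power2_eq_square)
  have t: "t = r ^ 2" using assms by (simp add: r_def)
  have l2: "2 / 3 \<le> ln (2::real)" "ln (2::real) \<le> 1" using ln2_ge_two_thirds ln_le_minus_one[of 2] by auto
  have "log 2 r = log 2 (8 * (r / 8))" by simp
  also have "\<dots> = log 2 (2 ^ 3) + log 2 (r / 8)" using r by (subst log_mult) auto
  also have "log 2 (2 ^ 3 :: real) = 3" by (subst log_pow_cancel) auto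
  also have "log 2 (r / 8) \<le> (r / 8 - 1) / ln 2"
    unfolding log_def using r l2 by (intro divide_right_mono ln_le_minus_one) auto
  also have "(r / 8 - 1) / ln 2 \<le> 9 / 20 * r - 3"
  proof (cases "r \<le> 8")
    case True
    then have "(r / 8 - 1) / ln 2 \<le> r / 8 - 1"
      using l2 by (simp add: divide_le_eq mult_left_mono_neg[of "ln 2" 1 "r / 8 - 1", simplified] field_simps)
        (use mult_nonneg_nonneg[of "8 - r" "1 - ln 2"] in \<open>simp add: algebra_simps\<close>)
    then show ?thesis using r by simp
  next
    case False
    have "(r / 8 - 1) / ln 2 \<le> (r / 8 - 1) / (2 / 3)"
      using l2 False by (intro divide_left_mono) auto
    also have "(r / 8 - 1) / (2 / 3) = 3 / 16 * r - 3 / 2" by (simp add: field_simps)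
    also have "\<dots> \<le> 9 / 20 * r - 3" using False by simp
    finally show ?thesis .
  qed
  finally have "log 2 r \<le> 9 / 20 * r" by simp
  moreover have "log 2 t = 2 * log 2 r" using r by (simp add: t log_nat_power)
  ultimately show ?thesis by (simp add: r_def)
qed

text \<open>In terms of \<open>t = m powr (\<delta> / 2)\<close> the hypothesis on \<open>m\<close>
  gives \<open>50 * n / \<delta> \<le> t\<close>. Then \<open>n * log 2 m\<close>, and with it
  \<open>T\<close>, is at most of order \<open>t * sqrt t\<close>, while
  \<open>sqrt n \<le> sqrt t / 7\<close>; so \<open>4 * T * sqrt n\<close> stays below
  \<open>t * t / 20\<close>, and \<open>t * t = m powr \<delta>\<close>.\<close>

lemma parameter_bounds:
  fixes n m T :: nat and \<delta> :: real
  assumes n: "1 \<le> n" and \<delta>: "0 < \<delta>" "\<delta> < 1"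
    and m: "(50 * real n / \<delta>) powr (2 / \<delta>) \<le> real m"
    and T: "real T \<le> 2 * (real n * log 2 (real m)) + 3"
  shows "11 \<le> log 2 (real m)"
    and "real (4 * T) / (real m powr \<delta>) * sqrt (real n) \<le> 1 / 20"
proof -
  define t where "t = real m powr (\<delta> / 2)"
  define D where "D = real n * log 2 (real m)"
  have pos: "0 < (50 * real n / \<delta>) powr (2 / \<delta>)" using n \<delta> by simp
  then have m0: "0 < real m" using m by linarith
  have "((50 * real n / \<delta>) powr (2 / \<delta>)) powr (\<delta> / 2) \<le> t"
    unfolding t_def using m \<delta> pos by (intro powr_mono2) auto
  then have tn: "50 * real n / \<delta> \<le> t" using n \<delta> by (simp add: powr_powr)
  have "50 * real n * 1 \<le> 50 * real n / \<delta>"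
    using n \<delta> by (simp add: pos_le_divide_eq)
  then have t50: "50 * real n \<le> t" using tn by simp
  then have t0: "50 \<le> t" using n by linarith
  have mt: "real m = t powr (2 / \<delta>)" using m0 \<delta> by (simp add: t_def powr_powr)
  have "2 ^ 11 \<le> (50::real) ^ 2" by simp
  also have "\<dots> \<le> t ^ 2" using t0 by (intro power_mono) auto
  also have "\<dots> = t powr 2" using t0 by simp
  also have "\<dots> \<le> real m" unfolding mt using t0 \<delta> by (intro powr_mono) (auto simp: pos_le_divide_eq)
  finally have "log 2 (2 ^ 11) \<le> log 2 (real m)" using m0 by (subst log_le_cancel_iff) auto
  moreover have "log 2 (2 ^ 11 :: real) = 11" by (subst log_pow_cancel) auto
  ultimately show lm: "11 \<le> log 2 (real m)" by linarith
  then have "1 * 11 \<le> D" unfolding D_def using n by (intro mult_mono) auto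
  \<comment> \<open>The additive 12 in \<open>8 * D + 12\<close> is absorbed using
    \<open>11 \<le> D\<close>.\<close>
  then have T4: "real (4 * T) \<le> 91 / 10 * D" using T by (simp add: D_def)
  have lt: "0 \<le> log 2 t" using t0 by simp
  have "D = (2 * real n / \<delta>) * log 2 t" using t0 by (simp add: D_def mt log_powr)
  also have "\<dots> \<le> (t / 25) * log 2 t"
    using tn lt by (intro mult_right_mono) (auto simp: field_simps)
  also have "\<dots> \<le> (t / 25) * (9 / 10 * sqrt t)"
    using t0 by (intro mult_left_mono log2_le_sqrt) auto
  finally have "real (4 * T) \<le> 91 / 10 * (t / 25 * (9 / 10 * sqrt t))" using T4 by linarith
  then have "real (4 * T) * sqrt (real n) \<le> 91 / 10 * (t / 25 * (9 / 10 * sqrt t)) * sqrt (real n)"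
    by (intro mult_right_mono) auto
  also have "\<dots> = (819 / 2500) * t * (sqrt t * sqrt (real n))" by simp
  also have "sqrt t * sqrt (real n) \<le> sqrt t * (sqrt t / 7)"
  proof (intro mult_left_mono)
    have "sqrt (real n) \<le> sqrt (t / 49)" using t50 by (intro real_sqrt_le_mono) auto
    also have "\<dots> = sqrt t / 7" by (simp add: real_sqrt_divide)
    finally show "sqrt (real n) \<le> sqrt t / 7" .
  qed (use t0 in auto)
  also have "sqrt t * (sqrt t / 7) = t / 7" using t0 by simp
  finally have *: "real (4 * T) * sqrt (real n) \<le> (819 / 2500) * t * (t / 7)" using t0 by simp
  have "real m powr \<delta> = t * t" by (simp add: t_def flip: powr_add)
  moreover have "real (4 * T) * sqrt (real n) \<le> 1 / 20 * (t * t)"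
    using * zero_le_square[of t] by linarith
  ultimately show "real (4 * T) / (real m powr \<delta>) * sqrt (real n) \<le> 1 / 20"
    using t0 by (simp add: divide_le_eq)
qed

subsection \<open>Rectangles and spread sets of pointers\<close>

lemma ex_max_on:
  fixes a :: "'a \<Rightarrow> real"
  assumes "finite A" "A \<noteq> {}"
  shows "\<exists>x\<in>A. \<forall>x'\<in>A. a x' \<le> a x"
proof -
  have "Max (a ` A) \<in> a ` A" using assms by simp
  then obtain x where x: "x \<in> A" "Max (a ` A) = a x" by auto
  moreover have "\<forall>x'\<in>A. a x' \<le> Max (a ` A)" using assms by simp
  ultimately show ?thesis by auto
qed

text \<open>
  This is why the simulation can always move to a single child, for all assignments at once.
\<close>

lemma half_rectangle:
  fixes A :: "'a set" and B :: "'b set"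
  assumes fin: "finite A" "finite B" and T: "triangle X Y T" and sub: "A \<subseteq> X" "B \<subseteq> Y"
    and ne: "A \<noteq> {}" and cover: "A \<times> B \<subseteq> T \<union> T'"
  obtains A' B' where "A' \<subseteq> A" "B' \<subseteq> B" "card A \<le> 2 * card A'" "card B \<le> 2 * card B'"
    "A' \<times> B' \<subseteq> T \<or> A' \<times> B' \<subseteq> T'"
proof -
  from T obtain a b where T_eq: "T = {(x, y). x \<in> X \<and> y \<in> Y \<and> a x < (b y :: real)}"
    by (auto simp: triangle_def)
  \<comment> \<open>\<open>P\<close> holds the pointers lying below at least half of
    \<open>B\<close>. If \<open>P\<close> is large, its element with the largest \<open>a\<close>
    serves all of \<open>P\<close>. Otherwise the half of \<open>B\<close> not above the remaining
    element with the smallest \<open>a\<close> avoids \<open>T\<close> on the whole remainder and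
    falls into \<open>T'\<close>.\<close>
  define P where "P = {x \<in> A. card B \<le> 2 * card {y \<in> B. a x < b y}}"
  have P_sub: "P \<subseteq> A" by (auto simp: P_def)
  have finP: "finite P" "finite (A - P)" using fin by (auto simp: P_def)
  have split: "card A = card P + card (A - P)"
    using fin P_sub by (simp add: card_Diff_subset card_mono finite_subset)
  show thesis
  proof (cases "card A \<le> 2 * card P")
    case True
    then have "P \<noteq> {}" using ne fin by auto
    with finP obtain x0 where x0: "x0 \<in> P" "\<And>x. x \<in> P \<Longrightarrow> a x \<le> a x0"
      using ex_max_on[of P a] by blast
    show thesis
    proof (rule that[OF P_sub _ True])
      show "{y \<in> B. a x0 < b y} \<subseteq> B" by auto
      show "card B \<le> 2 * card {y \<in> B. a x0 < b y}" using x0(1) by (simp add: P_def)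
      have "(x, y) \<in> T" if "x \<in> P" "y \<in> B" "a x0 < b y" for x y
        using le_less_trans[OF x0(2)[OF that(1)] that(3)] that subsetD[OF P_sub] subsetD[OF sub(1)] subsetD[OF sub(2)]
        by (simp add: T_eq)
      then show "P \<times> {y \<in> B. a x0 < b y} \<subseteq> T \<or> P \<times> {y \<in> B. a x0 < b y} \<subseteq> T'" by blast
    qed
  next
    case False
    then have "A - P \<noteq> {}" using split by force
    with finP obtain x0 where x0: "x0 \<in> A - P" "\<And>x. x \<in> A - P \<Longrightarrow> a x0 \<le> a x"
      using ex_max_on[of "A - P" "\<lambda>x. - a x"] by auto
    show thesis
    proof (rule that[of "A - P" "{y \<in> B. b y \<le> a x0}"])
      show "card A \<le> 2 * card (A - P)" using False split by simp
      have "B = {y \<in> B. a x0 < b y} \<union> {y \<in> B. b y \<le> a x0}" by auto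
      then have "card B \<le> card {y \<in> B. a x0 < b y} + card {y \<in> B. b y \<le> a x0}"
        by (metis card_Un_le)
      moreover have "\<not> card B \<le> 2 * card {y \<in> B. a x0 < b y}" using x0(1) by (auto simp: P_def)
      ultimately show "card B \<le> 2 * card {y \<in> B. b y \<le> a x0}" by linarith
      have "(x, y) \<notin> T" if "x \<in> A - P" "y \<in> B" "b y \<le> a x0" for x y
        using x0(2)[OF that(1)] that unfolding T_eq by auto
      then show "(A - P) \<times> {y \<in> B. b y \<le> a x0} \<subseteq> T \<or> (A - P) \<times> {y \<in> B. b y \<le> a x0} \<subseteq> T'"
        using cover by blast
    qed auto
  qed
qed

text \<open>For \<open>\<kappa> = m powr \<delta>\<close> this is blockwise min-entropy of rate
  \<open>\<delta>\<close> off \<open>J\<close>, written without division.\<close>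

definition spread_off :: "nat \<Rightarrow> real \<Rightarrow> nat set \<Rightarrow> (nat \<Rightarrow> nat) set \<Rightarrow> bool" where
  "spread_off n \<kappa> J A \<longleftrightarrow> (\<forall>K \<gamma>. K \<subseteq> {..<n} - J \<longrightarrow>
     real (card {x \<in> A. \<forall>k\<in>K. x k = \<gamma> k}) * \<kappa> ^ card K \<le> real (card A))"

lemma finite_ind_X: "finite (ind_X m n)" and card_ind_X: "card (ind_X m n) = m ^ n"
  unfolding ind_X_def by (auto simp: finite_PiE card_PiE)

lemma card_ind_X_agreeing:
  assumes "K \<subseteq> {..<n}"
  shows "card {x \<in> ind_X m n. \<forall>k\<in>K. x k = \<gamma> k} \<le> m ^ (n - card K)"
proof -
  have "card {x \<in> ind_X m n. \<forall>k\<in>K. x k = \<gamma> k} \<le> card (({..<n} - K) \<rightarrow>\<^sub>E {..<m})"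
  proof (rule card_inj_on_le[where f = "\<lambda>x. restrict x ({..<n} - K)"])
    show "inj_on (\<lambda>x. restrict x ({..<n} - K)) {x \<in> ind_X m n. \<forall>k\<in>K. x k = \<gamma> k}"
    proof (rule inj_onI)
      fix x x' assume x: "x \<in> {x \<in> ind_X m n. \<forall>k\<in>K. x k = \<gamma> k}" and x': "x' \<in> {x \<in> ind_X m n. \<forall>k\<in>K. x k = \<gamma> k}"
        and eq: "restrict x ({..<n} - K) = restrict x' ({..<n} - K)"
      have "x i = x' i" if "i < n" for i
        using fun_cong[OF eq, of i] that x x' by (cases "i \<in> K") auto
      then show "x = x'" using x x' by (intro PiE_ext[of x "{..<n}" "\<lambda>_. {..<m}" x']) (auto simp: ind_X_def)
    qed
    show "(\<lambda>x. restrict x ({..<n} - K)) ` {x \<in> ind_X m n. \<forall>k\<in>K. x k = \<gamma> k} \<subseteq> ({..<n} - K) \<rightarrow>\<^sub>E {..<m}"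
      by (rule image_subsetI, rule restrict_PiE_iff[THEN iffD2]) (auto simp: ind_X_def PiE_iff)
  qed (auto intro: finite_PiE)
  also have "\<dots> = m ^ (n - card K)"
    using assms by (simp add: card_PiE card_Diff_subset finite_subset)
  finally show ?thesis .
qed

text \<open>The condition \<open>a x' \<le> a x\<close> lets one pointer stand in for a whole spread
  set: every \<open>y\<close> with \<open>a x < b y\<close> lies above all of
  \<open>A\<close>.\<close>

definition covered ::
  "nat \<Rightarrow> real \<Rightarrow> nat \<Rightarrow> ((nat \<Rightarrow> nat) \<Rightarrow> real) \<Rightarrow> (nat \<Rightarrow> nat) set \<Rightarrow> (nat \<Rightarrow> nat) \<Rightarrow> nat set \<Rightarrow> bool" where
  "covered n \<kappa> w a Z x J \<longleftrightarrow> J \<subseteq> {..<n} \<and> card J \<le> w \<and>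
     (\<exists>A \<subseteq> Z. A \<noteq> {} \<and> spread_off n \<kappa> J A \<and> (\<forall>x'\<in>A. a x' \<le> a x \<and> (\<forall>j\<in>J. x' j = x j)))"

text \<open>
  The uncovered set itself contains a heavy cylinder; were its core small, the cylinder would cover
  its own element of largest \<open>a\<close>-value.
\<close>

lemma card_uncovered:
  assumes Z: "Z \<subseteq> ind_X m n" and \<kappa>: "0 < \<kappa>" "\<kappa> \<le> real m"
  shows "real (card {x \<in> Z. \<not> (\<exists>J. covered n \<kappa> w a Z x J)}) \<le> real m ^ n * (\<kappa> / real m) ^ Suc w"
    (is "real (card ?E) \<le> _")
proof (rule ccontr)
  assume contra: "\<not> ?thesis"
  have m: "0 < real m" using \<kappa> by linarith
  have finE: "finite ?E" using finite_subset[OF Z finite_ind_X] by simp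
  have "0 \<le> real m ^ n * (\<kappa> / real m) ^ Suc w" using m \<kappa> by simp
  then have Epos: "0 < real (card ?E)" using contra by linarith
  \<comment> \<open>Heavy means that the share of the uncovered set is at least
    \<open>\<kappa>\<close> to the power of minus the codimension. The trivial cylinder qualifies,
    so there is a heavy one of largest codimension.\<close>
  define heavy where "heavy p \<longleftrightarrow> fst p \<subseteq> {..<n} \<and>
      real (card ?E) \<le> real (card {x \<in> ?E. \<forall>k\<in>fst p. x k = snd p k}) * \<kappa> ^ card (fst p)" for p :: "nat set \<times> (nat \<Rightarrow> nat)"
  have h0: "heavy ({}, undefined)" by (simp add: heavy_def)
  have h1: "\<forall>p. heavy p \<longrightarrow> card (fst p) < Suc n"
    unfolding heavy_def by (metis card_lessThan card_mono finite_lessThan less_Suc_eq_le)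
  obtain p where p: "heavy p" "\<And>q. heavy q \<Longrightarrow> card (fst q) \<le> card (fst p)"
    using ex_has_greatest_nat[of heavy, OF h0, of "\<lambda>p. card (fst p)", OF h1] by blast
  obtain J \<alpha> where p_eq: "p = (J, \<alpha>)" by (cases p)
  define A where "A = {x \<in> ?E. \<forall>k\<in>J. x k = \<alpha> k}"
  have J: "J \<subseteq> {..<n}" and hv: "real (card ?E) \<le> real (card A) * \<kappa> ^ card J"
    using p(1) by (auto simp: heavy_def p_eq A_def)
  have finJ: "finite J" using J finite_subset by blast
  have A_ne: "A \<noteq> {}" using hv Epos by (intro notI) simp
  have finA: "finite A" using finite_subset[OF _ finE, of A] by (auto simp: A_def)
  have spr: "spread_off n \<kappa> J A" unfolding spread_off_def
  proof (intro allI impI)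
    fix K \<gamma> assume K: "K \<subseteq> {..<n} - J"
    have finK: "finite K" using K finite_subset by blast
    \<comment> \<open>A cylinder violating spreadness off \<open>J\<close>, combined with the one on
      \<open>J\<close>, would be heavy of larger codimension.\<close>
    define q where "q = (J \<union> K, \<lambda>k. if k \<in> J then \<alpha> k else \<gamma> k)"
    have cJK: "card (J \<union> K) = card J + card K"
      using K finJ finK by (intro card_Un_disjoint) auto
    have eq: "{x \<in> ?E. \<forall>k\<in>fst q. x k = snd q k} = {x \<in> A. \<forall>k\<in>K. x k = \<gamma> k}"
      using K by (auto simp: q_def A_def)
    show "real (card {x \<in> A. \<forall>k\<in>K. x k = \<gamma> k}) * \<kappa> ^ card K \<le> real (card A)"
    proof (cases "K = {}")
      case False
      then have "\<not> heavy q" using p(2)[of q] finK by (auto simp: q_def p_eq cJK card_gt_0_iff)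
      then have "real (card {x \<in> A. \<forall>k\<in>K. x k = \<gamma> k}) * \<kappa> ^ card (J \<union> K) < real (card ?E)"
        using J K unfolding heavy_def eq by (auto simp: q_def)
      also note hv
      finally have "(real (card {x \<in> A. \<forall>k\<in>K. x k = \<gamma> k}) * \<kappa> ^ card K) * \<kappa> ^ card J < real (card A) * \<kappa> ^ card J"
        by (simp add: cJK power_add mult_ac)
      then show ?thesis using \<kappa> by simp
    qed simp
  qed
  show False
  proof (cases "card J \<le> w")
    case True
    obtain x where x: "x \<in> A" "\<And>x'. x' \<in> A \<Longrightarrow> a x' \<le> a x"
      using ex_max_on[OF finA A_ne, of a] by blast
    have "covered n \<kappa> w a Z x J" unfolding covered_def
      using J True A_ne spr x by (intro conjI exI[of _ A]) (auto simp: A_def)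
    then show False using x(1) by (auto simp: A_def)
  next
    case False
    \<comment> \<open>A core larger than \<open>w\<close> makes the cylinder, and with it the
      uncovered set, too small; \<open>\<kappa> / m \<le> 1\<close> allows the exponent to drop to
      \<open>Suc w\<close>.\<close>
    have "A \<subseteq> {x \<in> ind_X m n. \<forall>k\<in>J. x k = \<alpha> k}" using Z by (auto simp: A_def)
    then have "card A \<le> card {x \<in> ind_X m n. \<forall>k\<in>J. x k = \<alpha> k}"
      using finite_ind_X by (intro card_mono) auto
    also have "\<dots> \<le> m ^ (n - card J)" by (rule card_ind_X_agreeing[OF J])
    finally have cA: "real (card A) \<le> real m ^ (n - card J)" by (metis of_nat_le_iff of_nat_power)
    have Jn: "card J \<le> n" using J by (metis card_lessThan card_mono finite_lessThan)
    have "real (card ?E) \<le> real m ^ (n - card J) * \<kappa> ^ card J"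
      by (rule order_trans[OF hv mult_right_mono[OF cA]]) (use \<kappa> in simp)
    also have "\<dots> = real m ^ n * (\<kappa> / real m) ^ card J"
      using Jn m by (simp add: power_divide power_diff)
    also have "\<dots> \<le> real m ^ n * (\<kappa> / real m) ^ Suc w"
      using False \<kappa> m by (intro mult_left_mono power_decreasing) auto
    finally show False using contra by simp
  qed
qed

text \<open>If every \<open>x\<close> in \<open>A\<close> had an unrealised assignment
  \<open>Z x\<close>, the partial assignments setting the pointed-to bits off \<open>J\<close> to
  \<open>Z x\<close> would form a spread family none of whose members is contained in any
  \<open>y\<close> from \<open>B\<close>. The sunflower lemma leaves too few such \<open>y\<close>,
  against \<open>B_large\<close>.\<close>

lemma full_range:
  fixes n m T :: nat and \<delta> :: real
  assumes n: "1 \<le> n" and \<delta>: "0 < \<delta>" "\<delta> < 1"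
    and m: "(50 * real n / \<delta>) powr (2 / \<delta>) \<le> real m"
    and T: "2 * (real n * log 2 (real m)) \<le> real T" "real T \<le> 2 * (real n * log 2 (real m)) + 3"
    and A: "A \<subseteq> ind_X m n" "A \<noteq> {}" and J: "J \<subseteq> {..<n}"
    and A_J: "\<And>x j. x \<in> A \<Longrightarrow> j \<in> J \<Longrightarrow> x j = \<alpha> j"
    and A_spread: "\<And>K \<gamma>. K \<subseteq> {..<n} - J \<Longrightarrow>
      real (card {x \<in> A. \<forall>k\<in>K. x k = \<gamma> k}) * (real m powr \<delta>) ^ card K \<le> 2 * real (card A)"
    and B: "B \<subseteq> ind_Y m n" and B_J: "\<And>y j. y \<in> B \<Longrightarrow> j \<in> J \<Longrightarrow> y j (\<alpha> j) = \<beta> j"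
    and B_large: "(1 / 2) ^ T * 2 ^ (n * m - card J) < real (card B)"
  shows "\<exists>x\<in>A. \<forall>z. (\<forall>j\<in>J. z j = \<beta> j) \<longrightarrow> (\<exists>y\<in>B. \<forall>j<n. y j (x j) = z j)"
proof (rule ccontr)
  assume contra: "\<not> ?thesis"
  have "\<forall>x\<in>A. \<exists>z. (\<forall>j\<in>J. z j = \<beta> j) \<and> (\<forall>y\<in>B. \<exists>j<n. y j (x j) \<noteq> z j)"
  proof
    fix x assume x: "x \<in> A"
    have "\<not> (\<forall>z. (\<forall>j\<in>J. z j = \<beta> j) \<longrightarrow> (\<exists>y\<in>B. \<forall>j<n. y j (x j) = z j))"
      using contra bexI[OF _ x] by (rule contrapos_nn)
    then show "\<exists>z. (\<forall>j\<in>J. z j = \<beta> j) \<and> (\<forall>y\<in>B. \<exists>j<n. y j (x j) \<noteq> z j)" by simp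
  qed
  then obtain Z where Z: "\<And>x j. x \<in> A \<Longrightarrow> j \<in> J \<Longrightarrow> Z x j = \<beta> j"
    "\<And>x y. x \<in> A \<Longrightarrow> y \<in> B \<Longrightarrow> \<exists>j<n. y j (x j) \<noteq> Z x j"
    by metis
  define \<kappa> where "\<kappa> = real m powr \<delta>"
  have pb: "11 \<le> log 2 (real m)" "real (4 * T) / \<kappa> * sqrt (real n) \<le> 1 / 20"
    using parameter_bounds[OF n \<delta> m T(2)] by (auto simp: \<kappa>_def)
  have m0: "0 < m" using pb(1) by (cases m) (auto simp: log_def)
  have \<kappa>0: "0 < \<kappa>" using m0 by (simp add: \<kappa>_def)
  have finA: "finite A" using A finite_ind_X finite_subset by blast
  \<comment> \<open>The cells already fixed on \<open>B\<close> leave the ground set, so that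
    \<open>B\<close> has density above \<open>(1 / 2) ^ T\<close> in what remains.\<close>
  define U where "U = ({..<n} \<times> {..<m}) - (\<lambda>j. (j, \<alpha> j)) ` J"
  define s where "s x = (\<lambda>j. ((j, x j), Z x j)) ` ({..<n} - J)" for x
  have xm: "x j < m" if "x \<in> A" "j < n" for x j using A that by (auto simp: ind_X_def PiE_iff)
  have card_U: "card U = n * m - card J"
  proof -
    have "(\<lambda>j. (j, \<alpha> j)) ` J \<subseteq> {..<n} \<times> {..<m}" using A(2) A_J J xm by force
    moreover have "inj_on (\<lambda>j. (j, \<alpha> j)) J" by (auto intro: inj_onI)
    moreover have "finite J" using J finite_subset by blast
    ultimately show ?thesis unfolding U_def by (subst card_Diff_subset) (auto simp: card_image card_cartesian_product)
  qed
  have finU: "finite U" by (simp add: U_def)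
  have s_dom: "fst ` s x \<subseteq> U" if "x \<in> A" for x using xm[OF that] by (auto simp: s_def U_def)
  have s_inj: "inj_on fst (s x)" for x by (auto simp: s_def intro!: inj_onI)
  have s_card: "card (s x) \<le> n" for x
  proof -
    have "card (s x) \<le> card ({..<n} - J)" unfolding s_def by (rule card_image_le) simp
    also have "\<dots> \<le> card {..<n}" by (rule card_mono) auto
    finally show ?thesis by simp
  qed
  have spread: "real (card {x \<in> A. T' \<subseteq> s x}) * \<kappa> ^ card T' \<le> 2 * real (card A)"
    for T' :: "((nat \<times> nat) \<times> bool) set"
  proof (cases "\<exists>x0\<in>A. T' \<subseteq> s x0")
    case True
    then obtain x0 where x0: "x0 \<in> A" "T' \<subseteq> s x0" by blast
    define K where "K = (\<lambda>q. fst (fst q)) ` T'"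
    have "inj_on (\<lambda>q. fst (fst q)) (s x0)" by (auto simp: s_def intro!: inj_onI)
    then have cK: "card K = card T'" unfolding K_def using x0(2) by (intro card_image) (rule inj_on_subset)
    have K: "K \<subseteq> {..<n} - J" using x0(2) by (auto simp: K_def s_def)
    have "{x \<in> A. T' \<subseteq> s x} \<subseteq> {x \<in> A. \<forall>k\<in>K. x k = x0 k}"
    proof safe
      fix x k assume x: "T' \<subseteq> s x" and "k \<in> K"
      then obtain q where q: "q \<in> T'" "k = fst (fst q)" by (auto simp: K_def)
      have "q \<in> s x" "q \<in> s x0" using q x x0 by auto
      then show "x k = x0 k" using q(2) by (auto simp: s_def)
    qed
    then have "card {x \<in> A. T' \<subseteq> s x} \<le> card {x \<in> A. \<forall>k\<in>K. x k = x0 k}"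
      using finA by (intro card_mono) auto
    then have "real (card {x \<in> A. T' \<subseteq> s x}) * \<kappa> ^ card T' \<le> real (card {x \<in> A. \<forall>k\<in>K. x k = x0 k}) * \<kappa> ^ card K"
      using \<kappa>0 cK by (intro mult_mono) auto
    also have "\<dots> \<le> 2 * real (card A)" unfolding \<kappa>_def by (rule A_spread[OF K])
    finally show ?thesis .
  next
    case False
    then have none: "{x \<in> A. T' \<subseteq> s x} = {}" by blast
    show ?thesis unfolding none by simp
  qed
  have "real (card (missed A s U)) \<le> (1 / 2) ^ T * 2 ^ card U"
  proof (rule card_missed[OF finA A(2) finU s_dom s_inj s_card \<kappa>0 spread])
    fix a b assume ab: "a < 2 * T" "b < 2 * T" "a \<noteq> b"
    define R where "R = nat \<lfloor>sqrt (real n)\<rfloor>"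
    define \<eta> where "\<eta> = real (2 * (2 * T)) / \<kappa>"
    have \<eta>: "0 \<le> \<eta>" "\<eta> * sqrt (real n) \<le> 1 / 20" using pb(2) \<kappa>0 by (auto simp: \<eta>_def)
    have tails: "2 * (\<Sum>i=Suc R..n. real (n choose i) * \<eta> ^ i) + 2 * (\<Sum>i=1..R. real (R choose i) * \<eta> ^ i) \<le> 9 / 20"
      unfolding R_def by (rule binomial_tails_le[OF \<eta>])
    \<comment> \<open>Clashes contribute at most \<open>1 / 20\<close>, which with
      \<open>9 / 20\<close> from the tails makes up the failure rate of one half allowed per
      trial.\<close>
    have "20 * real n \<le> 2 * (real n * 11)" by simp
    also have "\<dots> \<le> 2 * (real n * log 2 (real m))" using pb(1) by (intro mult_left_mono) auto
    also note T(1)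
    finally have "real n / real (2 * (2 * T)) \<le> 1 / 20" using n by (simp add: divide_le_eq)
    then have "real n / real (2 * (2 * T)) + 2 * (\<Sum>i=Suc R..n. real (n choose i) * \<eta> ^ i)
      + 2 * (\<Sum>i=1..R. real (R choose i) * \<eta> ^ i) \<le> 1 / 2" using tails by linarith
    then have "(real n / real (2 * (2 * T)) + 2 * (\<Sum>i=Suc R..n. real (n choose i) * \<eta> ^ i)
      + 2 * (\<Sum>i=1..R. real (R choose i) * \<eta> ^ i)) * real (card (states U (2 * T))) \<le> 1 / 2 * real (card (states U (2 * T)))"
      by (intro mult_right_mono) auto
    with card_failing[OF finA A(2) finU s_dom s_inj s_card \<kappa>0 spread ab, of R] show "real (card (failing A s U (2 * T) a b)) \<le> 1 / 2 * real (card (states U (2 * T)))"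
      unfolding \<eta>_def by linarith
  qed
  moreover have "card B \<le> card (missed A s U)"
  proof (rule card_inj_on_le[where f = "\<lambda>y. \<lambda>u\<in>U. y (fst u) (snd u)"])
    show "inj_on (\<lambda>y. \<lambda>u\<in>U. y (fst u) (snd u)) B"
    proof (rule inj_onI)
      fix y y' assume y: "y \<in> B" and y': "y' \<in> B"
        and eq: "(\<lambda>u\<in>U. y (fst u) (snd u)) = (\<lambda>u\<in>U. y' (fst u) (snd u))"
      have yY: "y \<in> {..<n} \<rightarrow>\<^sub>E cube m" "y' \<in> {..<n} \<rightarrow>\<^sub>E cube m" using y y' B by (auto simp: ind_Y_def)
      show "y = y'"
      proof (rule PiE_ext[OF yY])
        fix j assume j: "j \<in> {..<n}"
        have "y j \<in> {..<m} \<rightarrow>\<^sub>E UNIV" "y' j \<in> {..<m} \<rightarrow>\<^sub>E UNIV"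
          using PiE_mem[OF yY(1) j] PiE_mem[OF yY(2) j] by (auto simp: cube_def)
        then show "y j = y' j"
        proof (rule PiE_ext)
          fix a assume a: "a \<in> {..<m}"
          show "y j a = y' j a"
          proof (cases "(j, a) \<in> U")
            case True
            then show ?thesis using fun_cong[OF eq, of "(j, a)"] by simp
          next
            case False
            then have "j \<in> J" "a = \<alpha> j" using j a by (auto simp: U_def)
            then show ?thesis using B_J[OF y, of j] B_J[OF y', of j] by simp
          qed
        qed
      qed
    qed
    show "(\<lambda>y. \<lambda>u\<in>U. y (fst u) (snd u)) ` B \<subseteq> missed A s U"
    proof (rule image_subsetI)
      fix y assume y: "y \<in> B"
      have "\<not> (\<forall>(u, v)\<in>s x. (\<lambda>u\<in>U. y (fst u) (snd u)) u = v)" if x: "x \<in> A" for x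
      proof -
        obtain j where j: "j < n" "y j (x j) \<noteq> Z x j" using Z(2)[OF x y] by blast
        then have jJ: "j \<notin> J" using A_J B_J Z(1) x y by metis
        then have "((j, x j), Z x j) \<in> s x" using j by (simp add: s_def)
        moreover have "(j, x j) \<in> U" using jJ j xm[OF x] by (auto simp: U_def)
        ultimately show ?thesis using j by force
      qed
      then show "(\<lambda>u\<in>U. y (fst u) (snd u)) \<in> missed A s U" unfolding missed_def by auto
    qed
    show "finite (missed A s U)" unfolding missed_def by (simp add: finite_PiE finU)
  qed
  ultimately show False using B_large by (simp add: card_U)
qed

subsection \<open>Resolution derivations\<close>

inductive derives :: "cnf \<Rightarrow> nat \<Rightarrow> nat \<Rightarrow> clause \<Rightarrow> bool" for F :: cnf and w :: nat where
  derives_axiom: "C \<in> set F \<Longrightarrow> card C \<le> w \<Longrightarrow> derives F w k C"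
| derives_resolvent: "derives F w k A \<Longrightarrow> derives F w k B \<Longrightarrow> resolvent A B C \<Longrightarrow> card C \<le> w \<Longrightarrow>
    derives F w (Suc k) C"

lemma derives_mono: "derives F w k C \<Longrightarrow> k \<le> k' \<Longrightarrow> derives F w k' C"
proof (induction arbitrary: k' rule: derives.induct)
  case (derives_axiom C k)
  then show ?case by (auto intro: derives.intros)
next
  case (derives_resolvent k A B C)
  then obtain k'' where "k' = Suc k''" "k \<le> k''" by (metis Suc_le_D Suc_le_mono)
  then show ?case using derives_resolvent by (auto intro: derives.intros)
qed

text \<open>The widest clause over the variables in \<open>J\<close> that \<open>\<beta>\<close>
  falsifies.\<close>

definition negation :: "nat set \<Rightarrow> (nat \<Rightarrow> bool) \<Rightarrow> clause" where
  "negation J \<beta> = (\<lambda>j. if \<beta> j then Neg j else Pos j) ` J"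

lemma card_negation_le: "finite J \<Longrightarrow> C \<subseteq> negation J \<beta> \<Longrightarrow> card C \<le> card J"
  by (metis card_image_le card_mono finite_imageI le_trans negation_def)

text \<open>Induction on \<open>D\<close>, branching on one variable at a time. Asking only for
  subclauses replaces weakening: a branch whose clause omits the variable is kept as it is,
  otherwise the two branches are resolved.\<close>

lemma derives_resolve_out:
  assumes "finite D" "finite P" "P \<inter> D = {}" "card (P \<union> D) \<le> w"
    and "\<And>\<beta>'. (\<forall>j\<in>P. \<beta>' j = \<beta> j) \<Longrightarrow> \<exists>C\<subseteq>negation (P \<union> D) \<beta>'. derives F w k C"
  shows "\<exists>C\<subseteq>negation P \<beta>. derives F w (k + card D) C"
  using assms
proof (induction D arbitrary: P \<beta> rule: finite_induct)
  case empty
  then show ?case by simp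
next
  case (insert i D)
  have eq: "insert i P \<union> D = P \<union> insert i D" by auto
  have i: "i \<notin> P" using insert.prems by auto
  have "\<exists>C\<subseteq>negation (insert i P) (\<beta>(i := b)). derives F w (k + card D) C" for b
  proof (rule insert.IH)
    show "finite (insert i P)" "insert i P \<inter> D = {}" "card (insert i P \<union> D) \<le> w"
      using insert by (auto simp: eq)
    fix \<beta>' assume "\<forall>j\<in>insert i P. \<beta>' j = (\<beta>(i := b)) j"
    then have "\<forall>j\<in>P. \<beta>' j = \<beta> j" using i by auto
    then show "\<exists>C\<subseteq>negation (insert i P \<union> D) \<beta>'. derives F w k C" unfolding eq by (rule insert.prems)
  qed
  then obtain C where C: "\<And>b. C b \<subseteq> negation (insert i P) (\<beta>(i := b))" "\<And>b. derives F w (k + card D) (C b)"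
    by metis
  have neg: "negation (insert i P) (\<beta>(i := b)) = insert (if b then Neg i else Pos i) (negation P \<beta>)" for b
    using i by (auto simp: negation_def)
  have cP: "card P \<le> w"
    by (rule order_trans[OF card_mono insert.prems(3)]) (use insert in auto)
  have card_ins: "card (insert i D) = Suc (card D)" using insert.hyps by simp
  consider b where "C b \<subseteq> negation P \<beta>" | "Pos i \<in> C False" "Neg i \<in> C True"
    using C(1)[of True] C(1)[of False] unfolding neg by (auto split: if_splits)
  then show ?case
  proof cases
    case 1
    then show ?thesis using C(2)[of b] by (metis card_ins add_Suc_right derives_mono le_SucI order_refl)
  next
    case 2
    define E where "E = (C False - {Pos i}) \<union> (C True - {Neg i})"
    have E: "E \<subseteq> negation P \<beta>" using C(1)[of True] C(1)[of False] unfolding neg E_def by auto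
    have "resolvent (C False) (C True) E" unfolding resolvent_def E_def using 2 by blast
    moreover have "card E \<le> w" using card_negation_le[OF insert.prems(1) E] cP by simp
    ultimately have "derives F w (Suc (k + card D)) E" using C(2) by (blast intro: derives_resolvent)
    then show ?thesis using E by (auto simp: card_ins)
  qed
qed

lemma relpow_decreasing:
  fixes h :: "'a \<Rightarrow> nat"
  assumes "\<And>u v. (u, v) \<in> E \<Longrightarrow> h v < h u" and "(u, v) \<in> E ^^ k"
  shows "k + h v \<le> h u"
  using assms(2)
proof (induction k arbitrary: v)
  case (Suc k)
  then obtain v' where "(u, v') \<in> E ^^ k" "(v', v) \<in> E" by auto
  then show ?case using Suc.IH assms(1)[of v' v] by fastforce
qed simp

text \<open>
  The nodes are the derived clauses reachable from the empty one, each with one derivation of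
  minimal height; heights decrease along edges.
\<close>

lemma refutation_of_derives:
  assumes F: "\<And>C. C \<in> set F \<Longrightarrow> finite C" and der: "derives F w k {}"
  shows "\<exists>(R :: nat rdag) cl. resolution_refutation F R cl \<and>
    refutation_width R cl \<le> w \<and> longest_path R \<le> k"
proof -
  define V where "V = \<Union> (set F)"
  have finV: "finite V" using F by (simp add: V_def)
  have der_V: "C \<subseteq> V" "card C \<le> w" if "derives F w j C" for j C
    using that by (induction rule: derives.induct) (auto simp: V_def resolvent_def)
  define ht where "ht C = (LEAST j. derives F w j C)" for C
  have ht: "derives F w (ht C) C" if "derives F w j C" for j C
    unfolding ht_def using that by (rule LeastI)
  have ht_le: "ht C \<le> j" if "derives F w j C" for j C
    unfolding ht_def using that by (rule Least_le)
  define der' where "der' C \<longleftrightarrow> (\<exists>j. derives F w j C)" for C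
  have ex_prem: "\<exists>p. der' (fst p) \<and> der' (snd p) \<and> resolvent (fst p) (snd p) C \<and> ht (fst p) < ht C \<and> ht (snd p) < ht C"
    if "der' C" "0 < ht C" for C
  proof -
    from that ht have "derives F w (ht C) C" by (auto simp: der'_def)
    then show ?thesis
    proof cases
      \<comment> \<open>An axiom has height 0, contrary to the assumption.\<close>
      case derives_axiom
      then have "derives F w 0 C" by (rule derives.derives_axiom)
      then show ?thesis using ht_le that by fastforce
    next
      case (derives_resolvent j A B)
      have "ht A \<le> j" "ht B \<le> j" using ht_le derives_resolvent by blast+
      then show ?thesis using derives_resolvent by (intro exI[of _ "(A, B)"]) (auto simp: der'_def)
    qed
  qed
  define prem where "prem C = (SOME p. der' (fst p) \<and> der' (snd p) \<and> resolvent (fst p) (snd p) C \<and> ht (fst p) < ht C \<and> ht (snd p) < ht C)" for C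
  have prem: "der' (fst (prem C))" "der' (snd (prem C))" "resolvent (fst (prem C)) (snd (prem C)) C"
    "ht (fst (prem C)) < ht C" "ht (snd (prem C)) < ht C" if "der' C" "0 < ht C" for C
    using someI_ex[OF ex_prem[OF that]] unfolding prem_def by blast+
  define E where "E = {(C, D). der' C \<and> 0 < ht C \<and> (D = fst (prem C) \<or> D = snd (prem C))}"
  have E_der: "der' D" if "(C, D) \<in> E" for C D using that prem by (auto simp: E_def)
  have E_ht: "ht D < ht C" if "(C, D) \<in> E" for C D using that prem by (auto simp: E_def)
  define N where "N = {C. ({}, C) \<in> E\<^sup>*}"
  have N_der: "der' C" if "C \<in> N" for C
  proof -
    have "({}, C) \<in> E\<^sup>*" using that by (simp add: N_def)
    then show ?thesis by (induction rule: rtrancl_induct) (use der E_der in \<open>auto simp: der'_def\<close>)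
  qed
  have "N \<subseteq> Pow V" using N_der der_V by (auto simp: der'_def)
  then have finN: "finite N" using finV finite_subset by blast
  have E_N: "D \<in> N" if "(C, D) \<in> E" "C \<in> N" for C D using that by (auto simp: N_def intro: rtrancl_into_rtrancl)
  \<comment> \<open>Clauses are renamed to numbers because the nodes must have type
    \<open>nat\<close>; \<open>g\<close> recovers the clause.\<close>
  obtain f :: "clause \<Rightarrow> nat" where f: "inj_on f N" using finite_imp_inj_to_nat_seg[OF finN] by blast
  define g where "g = inv_into N f"
  have g: "g (f C) = C" if "C \<in> N" for C using f that by (simp add: g_def)
  define R where "R = \<lparr>nodes = f ` N, edges = {(f C, f D) | C D. C \<in> N \<and> (C, D) \<in> E}, dag_root = f {}\<rparr>"
  have E0: "{} \<in> N" by (simp add: N_def)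
  have nodes_R: "nodes R = f ` N" by (simp add: R_def)
  have edges: "(u, v) \<in> edges R \<longleftrightarrow> u \<in> f ` N \<and> v \<in> f ` N \<and> (g u, g v) \<in> E" for u v
    using E_N by (auto simp: R_def g) blast
  have edges_ht: "ht (g v) < ht (g u)" if "(u, v) \<in> edges R" for u v
    using that E_ht by (simp add: edges)
  have acyc: "acyclic (edges R)"
  proof -
    have "(edges R)\<inverse> \<subseteq> measure (\<lambda>u. ht (g u))" using edges_ht by auto
    then have "wf ((edges R)\<inverse>)" using wf_measure wf_subset by blast
    then show ?thesis by (metis wf_acyclic acyclic_converse)
  qed
  have reach: "(f {}, f C) \<in> (edges R)\<^sup>*" if "C \<in> N" for C
  proof -
    have "({}, C) \<in> E\<^sup>*" using that by (simp add: N_def)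
    then show ?thesis
    proof (induction rule: rtrancl_induct)
      case (step C D)
      have "C \<in> N" "D \<in> N" using step by (auto simp: N_def)
      then have "(f C, f D) \<in> edges R" using step by (simp add: edges g)
      then show ?case using step by (meson rtrancl_into_rtrancl)
    qed simp
  qed
  have root: "rooted_dag R"
    unfolding rooted_dag_def
  proof (intro conjI ballI)
    show "edges R \<subseteq> nodes R \<times> nodes R" by (auto simp: nodes_R edges)
    show "(dag_root R, u) \<in> (edges R)\<^sup>*" if "u \<in> nodes R" for u
      using that reach by (auto simp: R_def)
  qed (use finN acyc E0 in \<open>auto simp: R_def\<close>)
  have children: "children R (f C) = (if 0 < ht C then {f (fst (prem C)), f (snd (prem C))} else {})" if C: "C \<in> N" for C
  proof -
    have "children R (f C) = f ` {D. (C, D) \<in> E}"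
    proof (rule set_eqI)
      fix v
      have "v \<in> children R (f C) \<longleftrightarrow> v \<in> f ` N \<and> (C, g v) \<in> E"
        using C by (simp add: children_def edges g)
      also have "\<dots> \<longleftrightarrow> v \<in> f ` {D. (C, D) \<in> E}" using E_N[OF _ C] by (auto simp: g)
      finally show "v \<in> children R (f C) \<longleftrightarrow> v \<in> f ` {D. (C, D) \<in> E}" .
    qed
    also have "{D. (C, D) \<in> E} = (if 0 < ht C then {fst (prem C), snd (prem C)} else {})"
      using N_der[OF C] by (auto simp: E_def)
    finally show ?thesis by auto
  qed
  have ref: "resolution_refutation F R g"
    unfolding resolution_refutation_def
  proof (intro conjI ballI root)
    show "g (dag_root R) = {}" using g[OF E0] by (simp add: R_def)
  next
    fix u assume "u \<in> leaves R"
    then obtain C where C: "C \<in> N" "u = f C" "children R (f C) = {}" by (auto simp: leaves_def R_def)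
    then have "ht C = 0" using children by (auto split: if_splits)
    then have "derives F w 0 C" using N_der[OF C(1)] ht by (metis der'_def)
    \<comment> \<open>At height 0 only the axiom rule applies.\<close>
    then have "C \<in> set F" by cases auto
    then show "g u \<in> set F" using C g by simp
  next
    fix u assume "u \<in> nodes R - leaves R"
    then obtain C where C: "C \<in> N" "u = f C" "children R (f C) \<noteq> {}" by (auto simp: leaves_def R_def)
    then have h: "0 < ht C" using children by (auto split: if_splits)
    have E2: "(C, fst (prem C)) \<in> E" "(C, snd (prem C)) \<in> E" using h N_der[OF C(1)] by (auto simp: E_def)
    have N2: "fst (prem C) \<in> N" "snd (prem C) \<in> N" using E_N[OF E2(1) C(1)] E_N[OF E2(2) C(1)] by auto
    show "\<exists>v w. children R u = {v, w} \<and> resolvent (g v) (g w) (g u)"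
      using children[OF C(1)] h C g N2 prem(3)[OF N_der[OF C(1)] h]
      by (intro exI[of _ "f (fst (prem C))"] exI[of _ "f (snd (prem C))"]) simp
  qed
  have width: "refutation_width R g \<le> w"
    unfolding refutation_width_def
  proof (subst Max_le_iff)
    show "finite ((\<lambda>u. card (g u)) ` nodes R)" "(\<lambda>u. card (g u)) ` nodes R \<noteq> {}"
      using finN E0 by (auto simp: R_def)
    show "\<forall>a\<in>(\<lambda>u. card (g u)) ` nodes R. a \<le> w"
      using N_der der_V(2) by (auto simp: R_def g der'_def)
  qed
  \<comment> \<open>\<open>longest_path\<close> admits paths from any node, so the height bound is
    needed at all of them.\<close>
  have root_top: "ht C \<le> k" if "C \<in> N" for C
  proof -
    have "({}, C) \<in> E\<^sup>*" using that by (simp add: N_def)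
    then have "ht C \<le> ht {}" by (induction rule: rtrancl_induct) (auto dest!: E_ht)
    then show ?thesis using ht_le[OF der] by simp
  qed
  have path_le: "j \<le> k" if "u \<in> nodes R" "(u, v) \<in> edges R ^^ j" for u v j
  proof -
    have "j + ht (g v) \<le> ht (g u)"
      by (rule relpow_decreasing[OF edges_ht that(2)])
    moreover have "ht (g u) \<le> k" using that(1) root_top by (auto simp: R_def g)
    ultimately show ?thesis by simp
  qed
  have "longest_path R \<le> k"
    unfolding longest_path_def
  proof (subst Max_le_iff)
    let ?S = "{j. \<exists>u\<in>nodes R. \<exists>v\<in>nodes R. (u, v) \<in> edges R ^^ j}"
    have "?S \<subseteq> {..k}" using path_le by auto
    then show "finite ?S" using finite_subset by blast
    have "0 \<in> ?S" using E0 by (auto simp: R_def)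
    then show "?S \<noteq> {}" by blast
    show "\<forall>a\<in>?S. a \<le> k" using path_le by auto
  qed
  then show ?thesis using ref width by blast
qed

subsection \<open>Simulation of the triangle-DAG\<close>

text \<open>
  Bad elements are removed level by level, leaves of the DAG first, so that whatever survives at a
  node is good for all of its descendants.
\<close>

primrec sieve :: "'b set \<Rightarrow> ('v \<Rightarrow> nat) \<Rightarrow> 'v set \<Rightarrow> ('v \<Rightarrow> 'b set \<Rightarrow> 'b set) \<Rightarrow> nat \<Rightarrow> 'b set" where
  "sieve X h N bad 0 = X"
| "sieve X h N bad (Suc k) = sieve X h N bad k - (\<Union>u\<in>{u \<in> N. h u = k}. bad u (sieve X h N bad k))"

lemma sieve_antimono: "j \<le> k \<Longrightarrow> sieve X h N bad k \<subseteq> sieve X h N bad j"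
  by (rule lift_Suc_antimono_le[of "sieve X h N bad"]) auto

lemma sieve_subset: "sieve X h N bad k \<subseteq> X"
  using sieve_antimono[of 0 k X h N bad] by simp

lemma sieve_avoids:
  assumes "u \<in> N" "h u < k" "x \<in> sieve X h N bad k"
  shows "x \<notin> bad u (sieve X h N bad (h u))"
  using sieve_antimono[of "Suc (h u)" k X h N bad] assms by auto

text \<open>Each node removes elements at most once, at level \<open>h u\<close>, so the total loss
  is at most \<open>c\<close> per node however many levels are sieved.\<close>

lemma card_sieve:
  assumes fin: "finite X" "finite N"
    and bad: "\<And>u Z. u \<in> N \<Longrightarrow> Z \<subseteq> X \<Longrightarrow> finite (bad u Z) \<and> real (card (bad u Z)) \<le> c"
    and c: "0 \<le> c"
  shows "real (card X) \<le> real (card (sieve X h N bad k)) + real (card N) * c"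
proof -
  have finN: "finite {u \<in> N. P u}" for P using fin by simp
  have "real (card X) \<le> real (card (sieve X h N bad k)) + real (card {u \<in> N. h u < k}) * c"
  proof (induction k)
    case (Suc k)
    let ?Z = "sieve X h N bad k" and ?L = "{u \<in> N. h u = k}"
    have finZ: "finite ?Z" using finite_subset[OF sieve_subset fin(1)] .
    have bad_Z: "finite (bad u ?Z)" "real (card (bad u ?Z)) \<le> c" if "u \<in> N" for u
      using bad[OF that sieve_subset[of X h N bad k]] by (rule conjunct1, rule conjunct2)
    have finU: "finite (\<Union>u\<in>?L. bad u ?Z)" using finN bad_Z(1) by (intro finite_UN_I) auto
    have "?Z \<subseteq> sieve X h N bad (Suc k) \<union> (\<Union>u\<in>?L. bad u ?Z)" by auto
    then have "card ?Z \<le> card (sieve X h N bad (Suc k) \<union> (\<Union>u\<in>?L. bad u ?Z))"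
      using finZ finU by (intro card_mono) auto
    also have "\<dots> \<le> card (sieve X h N bad (Suc k)) + card (\<Union>u\<in>?L. bad u ?Z)" by (rule card_Un_le)
    also have "card (\<Union>u\<in>?L. bad u ?Z) \<le> (\<Sum>u\<in>?L. card (bad u ?Z))" by (rule card_UN_le[OF finN])
    finally have "real (card ?Z) \<le> real (card (sieve X h N bad (Suc k)) + (\<Sum>u\<in>?L. card (bad u ?Z)))"
      by (simp only: of_nat_le_iff)
    also have "\<dots> = real (card (sieve X h N bad (Suc k))) + (\<Sum>u\<in>?L. real (card (bad u ?Z)))" by simp
    also have "(\<Sum>u\<in>?L. real (card (bad u ?Z))) \<le> (\<Sum>u\<in>?L. c)"
      by (intro sum_mono bad_Z(2)) simp
    also have "\<dots> = real (card ?L) * c" by simp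
    finally have 1: "real (card ?Z) \<le> real (card (sieve X h N bad (Suc k))) + real (card ?L) * c" by simp
    have "{u \<in> N. h u < Suc k} = {u \<in> N. h u < k} \<union> ?L" by auto
    also have "card \<dots> = card {u \<in> N. h u < k} + card ?L" using finN by (intro card_Un_disjoint) auto
    finally have "real (card {u \<in> N. h u < Suc k}) * c = real (card {u \<in> N. h u < k}) * c + real (card ?L) * c"
      by (simp add: distrib_right)
    then show ?case using Suc.IH 1 by linarith
  qed simp
  also have "real (card {u \<in> N. h u < k}) * c \<le> real (card N) * c"
    using fin c by (intro mult_right_mono) (auto intro: card_mono)
  finally show ?thesis by simp
qed

lemma card_ind_Y: "finite (ind_Y m n)" "card (ind_Y m n) = 2 ^ (n * m)"
proof -
  have "finite (cube m)" "card (cube m) = 2 ^ m" by (auto simp: cube_def card_PiE intro: finite_PiE)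
  then show "finite (ind_Y m n)" "card (ind_Y m n) = 2 ^ (n * m)"
    by (auto simp: ind_Y_def card_PiE power_mult mult.commute[of n] intro: finite_PiE)
qed

theorem mainTheorem12:
  fixes F :: cnf and n m w d :: nat and \<delta> :: real
    and G :: "'v rdag"
    and S :: "'v \<Rightarrow> ((nat \<Rightarrow> nat) \<times> (nat \<Rightarrow> nat \<Rightarrow> bool)) set"
  assumes "cnf_over n F" and "unsatisfiable n F"
    and "w \<le> n"
    and "0 < \<delta>" and "\<delta> < 1 - 1 / log 2 (real m)"
    and "real m \<ge> (50 * real n / \<delta>) powr (2 / \<delta>)"
    and "solving_triangle_dag (ind_X m n) (ind_Y m n) {..<length F}
           (compose_ind m n (search n F)) G S"
    and "real (dag_size G) \<le> 1 / 2 * real m powr ((1 - \<delta>) * real w)"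
    and "dag_depth G = d"
  shows "\<exists>(R :: nat rdag) cl. resolution_refutation F R cl \<and>
           refutation_width R cl \<le> w \<and> longest_path R \<le> d * w"
proof -

  \<comment> \<open>Unpacking the hypotheses and fixing the parameters\<close>
  define X where "X = ind_X m n"
  define Y where "Y = ind_Y m n"
  define N where "N = nodes G"
  define E where "E = edges G"
  have dag: "rooted_dag G" and chl: "\<And>u. u \<in> N \<Longrightarrow> card (children G u) \<le> 2"
    and tri: "\<And>u. u \<in> N \<Longrightarrow> triangle X Y (S u)" and S_root: "S (dag_root G) = X \<times> Y"
    and S_inner: "\<And>u. u \<in> N \<Longrightarrow> u \<notin> leaves G \<Longrightarrow> S u \<subseteq> (\<Union>v\<in>children G u. S v)"
    and S_leaf: "\<And>u. u \<in> leaves G \<Longrightarrow> \<exists>i<length F. \<forall>p\<in>S u. (p, i) \<in> compose_ind m n (search n F)"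
    using assms(7) unfolding solving_triangle_dag_def X_def Y_def N_def by blast+
  have finN: "finite N" and E_N: "E \<subseteq> N \<times> N" and acyc: "acyclic E" and rootN: "dag_root G \<in> N"
    using dag by (auto simp: rooted_dag_def N_def E_def)

  have size: "1 \<le> card N" using finN rootN by (auto simp: Suc_le_eq card_gt_0_iff)
  \<comment> \<open>For \<open>w = 0\<close> the size bound would be at most one half, yet there is
    a root.\<close>
  have w0: "w \<noteq> 0"
  proof
    assume "w = 0"
    then have "real (card N) \<le> 1 / 2 * real m powr 0" using assms(8) by (simp add: N_def dag_size_def)
    then show False using size by (simp split: if_splits)
  qed
  then have n: "1 \<le> n" using assms(3) by simp
  have \<delta>0: "0 < \<delta>" by (fact assms(4))
  have "0 < (50 * real n / \<delta>) powr (2 / \<delta>)" using n \<delta>0 by simp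
  then have "0 < real m" using assms(6) by linarith
  then have m1: "1 \<le> real m" by simp
  have lm0: "0 \<le> log 2 (real m)" using m1 by simp
  then have \<delta>1: "\<delta> < 1" using assms(5) by (smt (verit) divide_nonneg_nonneg)
  define L where "L = real n * log 2 (real m)"
  have L0: "0 \<le> L" using lm0 by (simp add: L_def)
  \<comment> \<open>Chosen so that \<open>2 ^ T\<close> pays for \<open>m ^ n\<close> pointers times
    \<open>m ^ n\<close> nodes in the union bound over \<open>y\<close>; the added 2 compensates the
    factor 4 in \<open>\<epsilon>\<close>.\<close>
  define T where "T = nat \<lceil>2 * L\<rceil> + 2"
  have T: "2 * L + 2 \<le> real T" "real T \<le> 2 * L + 3" using L0 unfolding T_def by linarith+
  note par = parameter_bounds[OF n \<delta>0 \<delta>1 assms(6) T(2)[unfolded L_def]]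
  define \<kappa> where "\<kappa> = real m powr \<delta>"
  define M where "M = real m powr (1 - \<delta>)"
  have \<kappa>0: "0 < \<kappa>" and M0: "0 < M" using m1 by (auto simp: \<kappa>_def M_def)
  have \<kappa>M: "\<kappa> / real m = 1 / M" using m1 by (simp add: \<kappa>_def M_def powr_diff)
  have \<kappa>m: "\<kappa> \<le> real m" using powr_mono[of \<delta> 1 "real m"] m1 \<delta>1 by (simp add: \<kappa>_def)
  \<comment> \<open>The upper bound on \<open>\<delta>\<close> amounts to
    \<open>m powr (1 - \<delta>)\<close> exceeding 2.\<close>
  have "1 < (1 - \<delta>) * log 2 (real m)" using assms(5) par(1) by (simp add: field_simps)
  then have "2 powr 1 < (2::real) powr ((1 - \<delta>) * log 2 (real m))" by (rule powr_less_mono) simp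
  also have "\<dots> = M"
  proof -
    have "2 powr ((1 - \<delta>) * log 2 (real m)) = (2 powr log 2 (real m)) powr (1 - \<delta>)"
      by (simp add: powr_powr mult.commute)
    then show ?thesis using m1 by (simp add: M_def)
  qed
  finally have M2: "2 < M" by simp
  have NM: "real (card N) \<le> 1 / 2 * M ^ w"
  proof -
    have "M ^ w = real m powr ((1 - \<delta>) * real w)"
      unfolding powr_realpow[OF M0, symmetric] by (simp add: M_def powr_powr)
    then show ?thesis using assms(8) unfolding N_def dag_size_def by argo
  qed
  \<comment> \<open>One factor 2 is lost when \<open>B\<close> is halved; the other keeps the
    density bound required by \<open>full_range\<close> strict.\<close>
  define \<epsilon> :: real where "\<epsilon> = 4 * (1 / 2) ^ T"
  have \<epsilon>0: "0 < \<epsilon>" by (simp add: \<epsilon>_def)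
  have m_exp: "2 powr L = real m ^ n"
  proof -
    have "2 powr L = (2 powr log 2 (real m)) powr real n" by (simp add: L_def powr_powr mult.commute)
    then show ?thesis using m1 by (simp add: powr_realpow)
  qed
  have "2 powr (2 * L + 2) \<le> 2 powr real T" using T by (intro powr_mono) auto
  moreover have "2 powr (2 * L + 2) = 4 * (real m ^ n * real m ^ n)"
  proof -
    have "2 * L + 2 = L + L + 2" by simp
    then have "2 powr (2 * L + 2) = 2 powr L * 2 powr L * 2 powr 2" by (simp only: powr_add)
    then show ?thesis by (simp add: m_exp)
  qed
  ultimately have mT: "4 * (real m ^ n * real m ^ n) \<le> 2 ^ T" by (simp add: powr_realpow)
  have mn1: "1 \<le> real m ^ n" using m1 by simp
  have \<epsilon>m: "\<epsilon> * (real m ^ n * real m ^ n) \<le> 1"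
    using mT by (simp add: \<epsilon>_def power_divide)
  have finX: "finite X" and cX: "card X = m ^ n" and finY: "finite Y" and cY: "card Y = 2 ^ (n * m)"
    using finite_ind_X card_ind_X card_ind_Y by (auto simp: X_def Y_def)

  \<comment> \<open>Heights of the nodes and threshold functions of their triangles\<close>
  define h where "h u = card (E\<^sup>+ `` {u})" for u
  have h_dec: "h v < h u" if "(u, v) \<in> E" for u v
    unfolding h_def
  proof (rule psubset_card_mono)
    have "E\<^sup>+ \<subseteq> N \<times> N" using E_N by (rule trancl_subset_Sigma)
    then have "E\<^sup>+ `` {u} \<subseteq> N" by blast
    then show "finite (E\<^sup>+ `` {u})" using finN by (rule finite_subset)
    have "v \<notin> E\<^sup>+ `` {v}" using acyc by (auto simp: acyclic_def)
    moreover have "v \<in> E\<^sup>+ `` {u}" using that by auto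
    moreover have "E\<^sup>+ `` {v} \<subseteq> E\<^sup>+ `` {u}" using that by (auto intro: trancl_into_trancl2)
    ultimately show "E\<^sup>+ `` {v} \<subset> E\<^sup>+ `` {u}" by blast
  qed
  have "\<forall>u. \<exists>a b. u \<in> N \<longrightarrow> S u = {(x, y). x \<in> X \<and> y \<in> Y \<and> a x < (b y :: real)}"
    using tri unfolding triangle_def by blast
  then obtain a b where "\<forall>u. u \<in> N \<longrightarrow> S u = {(x, y). x \<in> X \<and> y \<in> Y \<and> a u x < (b u y :: real)}"
    unfolding choice_iff by blast
  then have S_eq: "\<And>u. u \<in> N \<Longrightarrow> S u = {(x, y). x \<in> X \<and> y \<in> Y \<and> a u x < (b u y :: real)}" by blast

  \<comment> \<open>Sieving the pointers \<open>x\<close>\<close>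
  define badX where "badX u Z = {x \<in> Z. \<not> (\<exists>J. covered n \<kappa> w (a u) Z x J)}" for u Z
  define Zx where "Zx = sieve X h N badX"
  have Zx_X: "Zx k \<subseteq> X" for k unfolding Zx_def by (rule sieve_subset)
  have badX_card: "finite (badX u Z) \<and> real (card (badX u Z)) \<le> real m ^ n * (1 / M) ^ Suc w" if "Z \<subseteq> X" for u Z
  proof
    show "finite (badX u Z)" using finite_subset[OF that finX] by (simp add: badX_def)
    show "real (card (badX u Z)) \<le> real m ^ n * (1 / M) ^ Suc w"
      unfolding badX_def \<kappa>M[symmetric] by (rule card_uncovered[OF that[unfolded X_def] \<kappa>0 \<kappa>m])
  qed
  have Zx_card: "real m ^ n / 2 \<le> real (card (Zx k))" for k
  proof -
    have "real (card X) \<le> real (card (Zx k)) + real (card N) * (real m ^ n * (1 / M) ^ Suc w)"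
      unfolding Zx_def using badX_card M0 by (intro card_sieve[OF finX finN]) auto
    also have "real (card N) * (real m ^ n * (1 / M) ^ Suc w) \<le> (1 / 2 * M ^ w) * (real m ^ n * (1 / M) ^ Suc w)"
      using NM M0 by (intro mult_right_mono) auto
    \<comment> \<open>The exponent \<open>Suc w\<close> beats the number of nodes by one more factor
      \<open>M\<close>, which exceeds 2.\<close>
    also have "\<dots> = real m ^ n * (1 / (2 * M))" using M0 by (simp add: power_divide)
    also have "\<dots> \<le> real m ^ n * (1 / 2)" using M2 by (intro mult_left_mono) auto
    finally show ?thesis by (simp add: cX)
  qed

  \<comment> \<open>Sieving the bit tables \<open>y\<close>\<close>
  define Jf where "Jf u x = (if \<exists>J. covered n \<kappa> w (a u) (Zx (h u)) x J
      then SOME J. covered n \<kappa> w (a u) (Zx (h u)) x J else {})" for u x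
  have Jf: "covered n \<kappa> w (a u) (Zx (h u)) x (Jf u x)" if "\<exists>J. covered n \<kappa> w (a u) (Zx (h u)) x J" for u x
    using that someI_ex[OF that] by (simp add: Jf_def)
  \<comment> \<open>The default \<open>{}\<close> makes this hold for every \<open>x\<close>. With
    one core fixed per node and pointer, the union bound over \<open>y\<close> has no sum over
    cores.\<close>
  have Jf_n: "Jf u x \<subseteq> {..<n}" for u x
  proof (cases "\<exists>J. covered n \<kappa> w (a u) (Zx (h u)) x J")
    case True
    from Jf[OF this] show ?thesis by (simp add: covered_def)
  next
    case False
    then show ?thesis by (simp add: Jf_def)
  qed
  \<comment> \<open>Density \<open>\<epsilon>\<close> within a subcube on which
    \<open>card J\<close> bits are prescribed.\<close>
  define dens where "dens J = \<epsilon> * 2 ^ (n * m - card J)" for J :: "nat set"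
  define Ys where "Ys u Z x \<beta> = {y \<in> Z. a u x < b u y \<and> (\<forall>j\<in>Jf u x. y j (x j) = \<beta> j)}" for u Z x \<beta>
  \<comment> \<open>A sparse set is discarded whole, so a single surviving element certifies that
    its set is dense.\<close>
  define sparse where "sparse u Z x \<beta> = (if real (card (Ys u Z x \<beta>)) < dens (Jf u x) then Ys u Z x \<beta> else {})" for u Z x \<beta>
  define badY where "badY u Z = (\<Union>x\<in>X. \<Union>\<beta>\<in>Jf u x \<rightarrow>\<^sub>E UNIV. sparse u Z x \<beta>)" for u Z
  define Zy where "Zy = sieve Y h N badY"
  have Zy_Y: "Zy k \<subseteq> Y" for k unfolding Zy_def by (rule sieve_subset)
  have finJ: "finite (Jf u x)" for u x using finite_subset[OF Jf_n] by simp
  have finJE: "finite (Jf u x \<rightarrow>\<^sub>E (UNIV :: bool set))" for u x using finJ by (auto intro: finite_PiE)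
  have badY_card: "finite (badY u Z) \<and> real (card (badY u Z)) \<le> real m ^ n * (\<epsilon> * 2 ^ (n * m))" if "Z \<subseteq> Y" for u Z
  proof
    have finZ: "finite Z" using finite_subset[OF that finY] .
    have finS: "finite (sparse u Z x \<beta>)" for x \<beta> using finZ by (simp add: sparse_def Ys_def)
    show "finite (badY u Z)" unfolding badY_def using finX finJE finS by blast
    have "card (badY u Z) \<le> (\<Sum>x\<in>X. card (\<Union>\<beta>\<in>Jf u x \<rightarrow>\<^sub>E UNIV. sparse u Z x \<beta>))"
      unfolding badY_def by (rule card_UN_le[OF finX])
    also have "\<dots> \<le> (\<Sum>x\<in>X. \<Sum>\<beta>\<in>Jf u x \<rightarrow>\<^sub>E UNIV. card (sparse u Z x \<beta>))"
      by (intro sum_mono card_UN_le finJE)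
    finally have "real (card (badY u Z)) \<le> real (\<Sum>x\<in>X. \<Sum>\<beta>\<in>Jf u x \<rightarrow>\<^sub>E UNIV. card (sparse u Z x \<beta>))"
      by (simp only: of_nat_le_iff)
    also have "\<dots> = (\<Sum>x\<in>X. \<Sum>\<beta>\<in>Jf u x \<rightarrow>\<^sub>E UNIV. real (card (sparse u Z x \<beta>)))" by simp
    also have "\<dots> \<le> (\<Sum>x\<in>X. \<Sum>\<beta>\<in>Jf u x \<rightarrow>\<^sub>E (UNIV :: bool set). dens (Jf u x))"
      using \<epsilon>0 by (intro sum_mono) (auto simp: sparse_def dens_def)
    \<comment> \<open>The \<open>2 ^ card J\<close> choices of \<open>\<beta>\<close> cancel the
      codimension in \<open>dens\<close>, so every \<open>x\<close> costs the same.\<close>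
    also have "\<dots> = (\<Sum>x\<in>X. \<epsilon> * 2 ^ (n * m))"
    proof (rule sum.cong[OF refl])
      fix x
      have "card (Jf u x) \<le> n" using card_mono[OF _ Jf_n] by simp
      also have "n \<le> n * m" using m1 by simp
      finally have "(2::real) ^ card (Jf u x) * 2 ^ (n * m - card (Jf u x)) = 2 ^ (n * m)"
        by (simp flip: power_add)
      then show "(\<Sum>\<beta>\<in>Jf u x \<rightarrow>\<^sub>E (UNIV :: bool set). dens (Jf u x)) = \<epsilon> * 2 ^ (n * m)"
        using finJ by (simp add: card_PiE dens_def mult_ac)
    qed
    finally show "real (card (badY u Z)) \<le> real m ^ n * (\<epsilon> * 2 ^ (n * m))" by (simp add: cX)
  qed
  have Zy_card: "\<epsilon> * 2 ^ (n * m) \<le> real (card (Zy k))" for k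
  proof -
    have "M ^ w \<le> M ^ n" using M2 assms(3) by (intro power_increasing) auto
    also have "\<dots> \<le> real m ^ n"
      using powr_mono[of "1 - \<delta>" 1 "real m"] m1 \<delta>0 M0 by (intro power_mono) (auto simp: M_def)
    finally have Nm: "real (card N) \<le> 1 / 2 * real m ^ n" using NM by linarith
    have "real (card Y) \<le> real (card (Zy k)) + real (card N) * (real m ^ n * (\<epsilon> * 2 ^ (n * m)))"
      unfolding Zy_def using badY_card \<epsilon>0 by (intro card_sieve[OF finY finN]) auto
    also have "real (card N) * (real m ^ n * (\<epsilon> * 2 ^ (n * m))) \<le> (1 / 2 * real m ^ n) * (real m ^ n * (\<epsilon> * 2 ^ (n * m)))"
      using Nm \<epsilon>0 by (intro mult_right_mono) auto
    also have "\<dots> = 1 / 2 * 2 ^ (n * m) * (\<epsilon> * (real m ^ n * real m ^ n))" by simp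
    also have "\<dots> \<le> 1 / 2 * 2 ^ (n * m) * 1" using \<epsilon>m by (intro mult_left_mono) auto
    finally have "1 / 2 * 2 ^ (n * m) \<le> real (card (Zy k))" by (simp add: cY)
    moreover have "\<epsilon> \<le> 1 / 2"
    proof -
      have "2 \<le> log 2 (real m) * real n" using mult_mono[of 2 "log 2 (real m)" 1 "real n"] par(1) n by simp
      then have "3 \<le> T" using T(1) by (simp add: L_def mult.commute)
      then have "(1 / 2 :: real) ^ T \<le> (1 / 2) ^ 3" by (intro power_decreasing) auto
      also have "\<dots> = 1 / 8" by (simp add: power3_eq_cube)
      finally show ?thesis unfolding \<epsilon>_def by linarith
    qed
    then have "\<epsilon> * 2 ^ (n * m) \<le> 1 / 2 * 2 ^ (n * m)" by (intro mult_right_mono) auto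
    ultimately show ?thesis by linarith
  qed

  \<comment> \<open>The pointers \<open>\<alpha>\<close> on \<open>J\<close> are hidden from the resolution proof, which only sees \<open>\<beta>\<close>.\<close>
  define state where "state u J \<beta> \<alpha> A B \<longleftrightarrow> J \<subseteq> {..<n} \<and> card J \<le> w \<and>
      A \<subseteq> Zx (h u) \<and> A \<noteq> {} \<and> (\<forall>x\<in>A. \<forall>j\<in>J. x j = \<alpha> j) \<and> spread_off n \<kappa> J A \<and>
      B \<subseteq> Zy (h u) \<and> (\<forall>y\<in>B. \<forall>j\<in>J. y j (\<alpha> j) = \<beta> j) \<and> dens J \<le> real (card B) \<and> A \<times> B \<subseteq> S u"
    for u J and \<beta> :: "nat \<Rightarrow> bool" and \<alpha> :: "nat \<Rightarrow> nat" and A B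

  \<comment> \<open>Realisable assignments, leaves, and moves to a child\<close>
  have range: "\<exists>x\<in>A'. \<forall>z. (\<forall>j\<in>J. z j = \<beta> j) \<longrightarrow> (\<exists>y\<in>B'. \<forall>j<n. y j (x j) = z j)"
    if st: "state u J \<beta> \<alpha> A B" and sub: "A' \<subseteq> A" "B' \<subseteq> B" and cA: "card A \<le> 2 * card A'" and cB: "card B \<le> 2 * card B'"
    for u J \<beta> \<alpha> A B A' B'
  proof (rule full_range[OF n \<delta>0 \<delta>1 assms(6), where \<alpha> = \<alpha>])
    show "2 * (real n * log 2 (real m)) \<le> real T" "real T \<le> 2 * (real n * log 2 (real m)) + 3"
      using T by (auto simp: L_def)
    have AZ: "A \<subseteq> Zx (h u)" and BZ: "B \<subseteq> Zy (h u)" and A_ne: "A \<noteq> {}" and Jn: "J \<subseteq> {..<n}"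
      using st by (simp_all add: state_def)
    have AX: "A \<subseteq> X" and BY: "B \<subseteq> Y"
      by (rule order_trans[OF AZ Zx_X], rule order_trans[OF BZ Zy_Y])
    have finA: "finite A" using AX finX by (rule finite_subset)
    show "A' \<subseteq> ind_X m n" "B' \<subseteq> ind_Y m n" "J \<subseteq> {..<n}"
      using sub AX BY Jn by (auto simp: X_def Y_def)
    show "A' \<noteq> {}" using A_ne cA finA by auto
    show "x j = \<alpha> j" if "x \<in> A'" "j \<in> J" for x j
      using st that subsetD[OF sub(1) that(1)] by (simp add: state_def)
    show "y j (\<alpha> j) = \<beta> j" if "y \<in> B'" "j \<in> J" for y j
      using st that subsetD[OF sub(2) that(1)] by (simp add: state_def)
    show "real (card {x \<in> A'. \<forall>k\<in>K. x k = \<gamma> k}) * (real m powr \<delta>) ^ card K \<le> 2 * real (card A')"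
      if K: "K \<subseteq> {..<n} - J" for K \<gamma>
    proof -
      have "card {x \<in> A'. \<forall>k\<in>K. x k = \<gamma> k} \<le> card {x \<in> A. \<forall>k\<in>K. x k = \<gamma> k}"
        using finA sub by (intro card_mono) auto
      then have "real (card {x \<in> A'. \<forall>k\<in>K. x k = \<gamma> k}) * \<kappa> ^ card K \<le> real (card {x \<in> A. \<forall>k\<in>K. x k = \<gamma> k}) * \<kappa> ^ card K"
        using \<kappa>0 by (intro mult_right_mono) auto
      also have "\<dots> \<le> real (card A)" using st K by (simp add: state_def spread_off_def)
      finally show ?thesis using cA unfolding \<kappa>_def by linarith
    qed
    have "(1 / 2) ^ T * 2 ^ (n * m - card J) < 1 / 2 * dens J" by (simp add: dens_def \<epsilon>_def)
    also have "dens J \<le> real (card B)" using st by (simp add: state_def)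
    finally show "(1 / 2) ^ T * 2 ^ (n * m - card J) < real (card B')" using cB by linarith
  qed

  have leaf: "\<exists>C\<subseteq>negation J \<beta>. C \<in> set F" if st: "state u J \<beta> \<alpha> A B" and u: "u \<in> leaves G" for u J \<beta> \<alpha> A B
  proof -
    obtain x where x: "x \<in> A" "\<And>z. (\<forall>j\<in>J. z j = \<beta> j) \<Longrightarrow> \<exists>y\<in>B. \<forall>j<n. y j (x j) = z j"
      using range[OF st subset_refl subset_refl] by auto
    obtain i where i: "i < length F" "\<And>p. p \<in> S u \<Longrightarrow> (p, i) \<in> compose_ind m n (search n F)"
      using S_leaf[OF u] by blast
    have "F ! i \<subseteq> negation J \<beta>"
    proof
      fix l assume l: "l \<in> F ! i"
      show "l \<in> negation J \<beta>"
      proof (rule ccontr)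
        assume nl: "l \<notin> negation J \<beta>"
        \<comment> \<open>This \<open>z\<close> satisfies \<open>l\<close>: off \<open>J\<close> by
          construction, on \<open>J\<close> because \<open>l\<close> is not among the literals
          falsified by \<open>\<beta>\<close>. As \<open>z\<close> extends \<open>\<beta>\<close>,
          it is realised inside the leaf.\<close>
        define z where "z k = (if k \<in> J then \<beta> k else l = Pos k)" for k
        obtain y where y: "y \<in> B" "\<forall>j<n. y j (x j) = z j" using x(2)[of z] by (auto simp: z_def)
        have "(x, y) \<in> S u" using st x(1) y(1) by (auto simp: state_def)
        from i(2)[OF this] have "\<not> clause_val (\<lambda>j\<in>{..<n}. ind (x j) (y j)) (F ! i)"
          by (auto simp: compose_ind_def search_def)
        then have "\<not> lit_val (\<lambda>j\<in>{..<n}. ind (x j) (y j)) l" using l by (auto simp: clause_val_def)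
        moreover have "lit_var l < n"
        proof -
          have "F ! i \<in> set F" using i(1) by simp
          then have "lit_var ` (F ! i) \<subseteq> {..<n}" using assms(1) unfolding cnf_over_def by blast
          then show ?thesis using l by blast
        qed
        ultimately show False using y(2) nl
          by (cases l; cases "lit_var l \<in> J") (auto simp: ind_def z_def negation_def image_iff split: if_splits)
      qed
    qed
    then show ?thesis using i(1) by (intro exI[of _ "F ! i"]) simp
  qed

  have step: "\<exists>v J'. (u, v) \<in> E \<and> J' \<subseteq> {..<n} \<and> card J' \<le> w \<and>
      (\<forall>\<beta>'. (\<forall>j\<in>J \<inter> J'. \<beta>' j = \<beta> j) \<longrightarrow> (\<exists>\<alpha>' A' B'. state v J' \<beta>' \<alpha>' A' B'))"
    if st: "state u J \<beta> \<alpha> A B" and u: "u \<in> N" "u \<notin> leaves G" for u J \<beta> \<alpha> A B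
  proof -
    have ch: "children G u \<noteq> {}" using u by (simp add: leaves_def N_def)
    have ch_N: "v \<in> N" "(u, v) \<in> E" if "v \<in> children G u" for v
      using that E_N by (auto simp: children_def E_def)
    have finC: "finite (children G u)" using ch_N finN finite_subset by (metis subsetI)
    obtain v1 v2 where v12: "children G u = {v1, v2}"
    proof -
      have "card (children G u) \<noteq> 0" using ch finC by simp
      then have "card (children G u) = 1 \<or> card (children G u) = 2" using chl[OF u(1)] by linarith
      then show thesis
      proof
        assume "card (children G u) = 1"
        then obtain v where "children G u = {v}" by (rule card_1_singletonE)
        then show thesis using that[of v v] by simp
      qed (auto simp: card_2_iff that)
    qed
    have v_N: "v1 \<in> N" "v2 \<in> N" using ch_N v12 by auto
    have AZ: "A \<subseteq> Zx (h u)" and BZ: "B \<subseteq> Zy (h u)" and A_ne: "A \<noteq> {}" and AB_S: "A \<times> B \<subseteq> S u"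
      using st by (simp_all add: state_def)
    have AX: "A \<subseteq> X" "B \<subseteq> Y"
      by (rule order_trans[OF AZ Zx_X], rule order_trans[OF BZ Zy_Y])
    have AB: "finite A" "finite B"
      by (rule finite_subset[OF AX(1) finX], rule finite_subset[OF AX(2) finY])
    have "S u \<subseteq> S v1 \<union> S v2" using S_inner[OF u] v12 by simp
    then have "A \<times> B \<subseteq> S v1 \<union> S v2" using AB_S by (rule order_trans[rotated])
    then obtain A' B' where sub: "A' \<subseteq> A" "B' \<subseteq> B" and cA: "card A \<le> 2 * card A'" and cB: "card B \<le> 2 * card B'"
      and or: "A' \<times> B' \<subseteq> S v1 \<or> A' \<times> B' \<subseteq> S v2"
      by (rule half_rectangle[OF AB tri[OF v_N(1)] AX A_ne])
    from or obtain v where v: "v \<in> children G u" and vS: "A' \<times> B' \<subseteq> S v" using v12 by blast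
    have vN: "v \<in> N" and uv: "(u, v) \<in> E" using ch_N[OF v] by auto
    have hv: "h v < h u" by (rule h_dec[OF uv])
    \<comment> \<open>\<open>x\<close> is fixed before \<open>\<beta>'\<close>, so one child and one
      core serve all assignments.\<close>
    obtain x where x: "x \<in> A'" and rng: "\<And>z. (\<forall>j\<in>J. z j = \<beta> j) \<Longrightarrow> \<exists>y\<in>B'. \<forall>j<n. y j (x j) = z j"
      using range[OF st sub cA cB] by blast
    have xX: "x \<in> X" using x sub AX by blast
    have xZ: "x \<in> Zx (h u)" using x sub(1) AZ by blast
    have "x \<notin> badX v (Zx (h v))" using sieve_avoids[of v N h "h u" x X badX] vN hv xZ by (simp add: Zx_def)
    moreover have "x \<in> Zx (h v)" using sieve_antimono[of "h v" "h u" X h N badX] hv xZ by (auto simp: Zx_def)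
    ultimately have "\<exists>J. covered n \<kappa> w (a v) (Zx (h v)) x J" by (simp add: badX_def)
    from Jf[OF this] obtain A1 where J': "Jf v x \<subseteq> {..<n}" "card (Jf v x) \<le> w"
      and A1: "A1 \<subseteq> Zx (h v)" "A1 \<noteq> {}" "spread_off n \<kappa> (Jf v x) A1"
        "\<And>x'. x' \<in> A1 \<Longrightarrow> a v x' \<le> a v x" "\<And>x' j. x' \<in> A1 \<Longrightarrow> j \<in> Jf v x \<Longrightarrow> x' j = x j"
      unfolding covered_def by blast
    have "\<exists>\<alpha>' A' B'. state v (Jf v x) \<beta>' \<alpha>' A' B'" if \<beta>': "\<forall>j\<in>J \<inter> Jf v x. \<beta>' j = \<beta> j" for \<beta>'
    proof -
      \<comment> \<open>Restricted because \<open>badY\<close> ranges over extensional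
        assignments.\<close>
      define \<gamma> where "\<gamma> = restrict \<beta>' (Jf v x)"
      define B1 where "B1 = Ys v (Zy (h v)) x \<gamma>"
      \<comment> \<open>\<open>y\<close> realises \<open>\<beta>\<close> on \<open>J\<close> and
        \<open>\<beta>'\<close> elsewhere; compatibility turns this into \<open>\<beta>'\<close> on
        the whole new core.\<close>
      obtain y where y: "y \<in> B'" "\<forall>j<n. y j (x j) = (if j \<in> J then \<beta> j else \<beta>' j)"
        using rng[of "\<lambda>j. if j \<in> J then \<beta> j else \<beta>' j"] by auto
      have yZ: "y \<in> Zy (h u)" using y(1) sub(2) BZ by blast
      have yv: "y \<in> Zy (h v)" using sieve_antimono[of "h v" "h u" Y h N badY] hv yZ by (auto simp: Zy_def)
      have "(x, y) \<in> S v" using vS x y(1) by blast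
      then have axy: "a v x < b v y" using S_eq[OF vN] by simp
      have "y j (x j) = \<gamma> j" if "j \<in> Jf v x" for j
      proof -
        have "j < n" using J'(1) that by auto
        then have "y j (x j) = (if j \<in> J then \<beta> j else \<beta>' j)" using y(2) by simp
        then show ?thesis using \<beta>' that by (simp add: \<gamma>_def)
      qed
      then have yB1: "y \<in> B1" using yv axy by (simp add: B1_def Ys_def)
      have "y \<notin> badY v (Zy (h v))" using sieve_avoids[of v N h "h u" y Y badY] vN hv yZ by (simp add: Zy_def)
      then have "y \<notin> sparse v (Zy (h v)) x \<gamma>" using xX by (auto simp: badY_def \<gamma>_def)
      then have dns: "dens (Jf v x) \<le> real (card B1)" using yB1 by (auto simp: sparse_def B1_def split: if_splits)
      \<comment> \<open>For \<open>x'\<close> in \<open>A1\<close> and \<open>y\<close> in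
        \<open>B1\<close>, \<open>a v x' \<le> a v x < b v y\<close>.\<close>
      have "A1 \<times> B1 \<subseteq> S v"
        unfolding S_eq[OF vN] using A1(1,4) Zx_X Zy_Y by (fastforce simp: B1_def Ys_def)
      then have "state v (Jf v x) \<beta>' x A1 B1"
        unfolding state_def using J' A1 dns by (auto simp: B1_def Ys_def \<gamma>_def)
      then show ?thesis by blast
    qed
    then show ?thesis using uv J' by blast
  qed

  \<comment> \<open>Depth accounting along the DAG\<close>
  have path_len: "k + h v \<le> h u" if "(u, v) \<in> E ^^ k" for u v k
    by (rule relpow_decreasing[OF h_dec that])
  have leaf_depth: "k \<le> d" if "u \<in> leaves G" "(dag_root G, u) \<in> E ^^ k" for u k
  proof -
    let ?K = "{k. \<exists>l\<in>leaves G. (dag_root G, l) \<in> E ^^ k}"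
    have "?K \<subseteq> {..h (dag_root G)}" using path_len by fastforce
    then have "finite ?K" using finite_subset by blast
    moreover have "k \<in> ?K" using that by blast
    ultimately show ?thesis using assms(9) Max_ge[of ?K k] by (simp add: dag_depth_def E_def)
  qed
  \<comment> \<open>Each level of the DAG has a budget of \<open>w\<close> resolution steps. The
    conjunct \<open>k \<le> d\<close>, which the leaves supply, keeps \<open>d - k\<close> from
    being truncated.\<close>
  have state_derives: "k \<le> d \<and> (\<exists>C\<subseteq>negation J \<beta>. derives F w (w * (d - k)) C)"
    if "u \<in> N" "(dag_root G, u) \<in> E ^^ k" "\<exists>\<alpha> A B. state u J \<beta> \<alpha> A B" for u k J \<beta>
    using that
  proof (induction "h u" arbitrary: u k J \<beta> rule: less_induct)
    case less
    then obtain \<alpha> A B where st: "state u J \<beta> \<alpha> A B" by blast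
    have J: "finite J" "card J \<le> w" using st finite_subset[of J "{..<n}"] by (auto simp: state_def)
    show ?case
    proof (cases "u \<in> leaves G")
      case True
      obtain C where C: "C \<subseteq> negation J \<beta>" "C \<in> set F" using leaf[OF st True] by blast
      then have "card C \<le> w" using card_negation_le[OF J(1) C(1)] J(2) by simp
      then show ?thesis using C leaf_depth[OF True less.prems(2)] by (blast intro: derives_axiom)
    next
      case False
      from step[OF st less.prems(1) False] obtain v J' where uv: "(u, v) \<in> E" and J': "J' \<subseteq> {..<n}" "card J' \<le> w"
        and nx: "\<And>\<beta>'. (\<forall>j\<in>J \<inter> J'. \<beta>' j = \<beta> j) \<Longrightarrow> \<exists>\<alpha>' A' B'. state v J' \<beta>' \<alpha>' A' B'" by blast
      have vN: "v \<in> N" using uv E_N by blast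
      have pv: "(dag_root G, v) \<in> E ^^ Suc k" using less.prems(2) uv by auto
      have IH: "Suc k \<le> d \<and> (\<exists>C\<subseteq>negation J' \<beta>'. derives F w (w * (d - Suc k)) C)"
        if "\<forall>j\<in>J \<inter> J'. \<beta>' j = \<beta> j" for \<beta>'
        by (rule less.hyps[OF h_dec[OF uv] vN pv nx[OF that]])
      have kd: "Suc k \<le> d" using IH[of \<beta>] by simp
      have finJ': "finite J'" using J'(1) finite_subset by blast
      have un: "J \<inter> J' \<union> (J' - J) = J'" by blast
      \<comment> \<open>Only the variables of \<open>J' - J\<close> are resolved out; those of
        \<open>J \<inter> J'\<close> are fixed by \<open>\<beta>\<close>, and \<open>J - J'\<close>
        is forgotten.\<close>
      have "\<exists>C\<subseteq>negation (J \<inter> J') \<beta>. derives F w (w * (d - Suc k) + card (J' - J)) C"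
        by (rule derives_resolve_out) (use J finJ' J' IH in \<open>auto simp: un\<close>)
      then obtain C where C: "C \<subseteq> negation (J \<inter> J') \<beta>" "derives F w (w * (d - Suc k) + card (J' - J)) C" by blast
      have "card (J' - J) \<le> w" using card_mono[OF finJ', of "J' - J"] J'(2) by simp
      moreover have "w * (d - Suc k) + w = w * (d - k)"
        using kd by (metis Suc_diff_Suc Suc_le_lessD add.commute mult_Suc_right)
      ultimately have "w * (d - Suc k) + card (J' - J) \<le> w * (d - k)" by linarith
      then have "derives F w (w * (d - k)) C" by (rule derives_mono[OF C(2)])
      moreover have "C \<subseteq> negation J \<beta>" using C(1) by (auto simp: negation_def)
      ultimately show ?thesis using kd by auto
    qed
  qed

  \<comment> \<open>The initial state at the root, with empty core\<close>
  have "state (dag_root G) {} (\<lambda>_. False) (\<lambda>_. 0) (Zx (h (dag_root G))) (Zy (h (dag_root G)))"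
    unfolding state_def
  proof (intro conjI)
    let ?A = "Zx (h (dag_root G))"
    show "?A \<noteq> {}" using Zx_card[of "h (dag_root G)"] mn1 by auto
    show "spread_off n \<kappa> {} ?A" unfolding spread_off_def
    proof (intro allI impI)
      fix K \<gamma> assume "K \<subseteq> {..<n} - {}"
      then have K: "K \<subseteq> {..<n}" by simp
      show "real (card {x \<in> ?A. \<forall>k\<in>K. x k = \<gamma> k}) * \<kappa> ^ card K \<le> real (card ?A)"
      proof (cases "K = {}")
        case False
        have finK: "finite K" using K finite_subset by blast
        have Kn: "card K \<le> n" using card_mono[OF _ K] by simp
        have "card {x \<in> ?A. \<forall>k\<in>K. x k = \<gamma> k} \<le> card {x \<in> ind_X m n. \<forall>k\<in>K. x k = \<gamma> k}"
          using Zx_X finX by (intro card_mono) (auto simp: X_def)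
        also have "\<dots> \<le> m ^ (n - card K)" by (rule card_ind_X_agreeing[OF K])
        finally have "real (card {x \<in> ?A. \<forall>k\<in>K. x k = \<gamma> k}) \<le> real m ^ (n - card K)"
          by (simp only: of_nat_le_iff flip: of_nat_power)
        then have "real (card {x \<in> ?A. \<forall>k\<in>K. x k = \<gamma> k}) * \<kappa> ^ card K \<le> real m ^ (n - card K) * \<kappa> ^ card K"
          using \<kappa>0 by (intro mult_right_mono) auto
        also have "\<dots> = real m ^ n * (\<kappa> / real m) ^ card K"
          using Kn m1 by (simp add: power_divide power_diff)
        also have "\<dots> = real m ^ n * (1 / M) ^ card K" by (simp only: \<kappa>M)
        \<comment> \<open>A nonempty \<open>K\<close> gains at least one factor
          \<open>1 / M\<close>, below one half, and at least half of all pointers survived the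
          sieve.\<close>
        also have "\<dots> \<le> real m ^ n * (1 / M) ^ 1"
          using M2 False finK by (intro mult_left_mono power_decreasing) (auto simp: Suc_le_eq card_gt_0_iff)
        also have "\<dots> \<le> real m ^ n * (1 / 2)" using M2 by (intro mult_left_mono) auto
        finally show ?thesis using Zx_card[of "h (dag_root G)"] by simp
      qed simp
    qed
    show "dens {} \<le> real (card (Zy (h (dag_root G))))" using Zy_card by (simp add: dens_def)
    show "?A \<times> Zy (h (dag_root G)) \<subseteq> S (dag_root G)" using Zx_X Zy_Y S_root by blast
  qed auto
  then have st0: "\<exists>\<alpha> A B. state (dag_root G) {} (\<lambda>_. False) \<alpha> A B" by (intro exI)
  have "(dag_root G, dag_root G) \<in> E ^^ 0" by simp
  then have "\<exists>C\<subseteq>negation {} (\<lambda>_. False). derives F w (w * (d - 0)) C"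
    using state_derives[OF rootN _ st0] by blast
  then have "derives F w (d * w) {}" by (simp add: negation_def mult.commute)
  moreover have "finite C" if "C \<in> set F" for C using assms(1) that by (simp add: cnf_over_def)
  ultimately show ?thesis by (intro refutation_of_derives) auto
qed

end
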